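(* Let $g$ be a Riemannian metric on $S^3$. There is no $\mathbb{Z}/2$ harmonic $1$-form $\mathbf v$ on $(S^3,g)$, with zero locus denoted by $Z$, satisfying both of the following conditions: 1. Every zero point of $\mathbf v$ (i.e. every point of $Z$) is cylindrical. 2. For every arc $\gamma$ in $S^3\setminus Z$ transverse to $\ker\mathbf v$, with endpoints $x,y$, we have $\mu_{\mathbf v}(\gamma)=d_{S^3,\mathbf v}(x,y)$.
   Context: A $\mathbb{Z}/2$ harmonic 1-form on a Riemannian $n$-manifold $M$ is a closed subset $Z\subsetneq M$ (the zero locus) together with a two-valued section $\mathbf{v}$ of $T^*M$ over $M\setminus Z$ such that: (i) each $x\notin Z$ has an open neighborhood $U\subset M\setminus Z$ on which the values of $\mathbf v$ are $\pm v$, with $v$ a non-vanishing section of $T^*M|_U$ satisfying $dv=0$, $d^*v=0$; (ii) for every open $U\subset M$ with compact closure, $\int_{U\setminus Z}|\mathbf v|^2<\infty$ and $\int_{U\setminus Z}|\nabla\mathbf v|^2<\infty$; (iii) there are constants $C$ and $\epsilon>0$ such that for every $x\in Z$ and every $r<1$ less than the injectivity radius at $x$, $\int_{B_r(x)}|\mathbf v|^2<C r^{n+\epsilon}$. Here $|\mathbf v|,|\nabla\mathbf v|$ are the pointwise values $|v|,|\nabla v|$ with $v$ as in (i). Set $\mathbf v=0$ on $Z$. $\ker\mathbf v$ is the codimension-one foliation on $M\setminus Z$ locally given by $\ker v$. A point $p\in Z$ is cylindrical if there is a local coordinate chart $(x_1,\dots,x_n)$ on a neighborhood of $p$ in which $\mathbf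 v=\varphi\cdot\mathrm{Re}(d\sqrt{z^k})$ (as two-valued forms) for some integer $k\ge3$, where $\varphi$ is a smooth non-vanishing function and $z=x_1+x_2\sqrt{-1}$. For a $\mathcal C^1$ arc $\gamma:[0,1]\to M\setminus Z$, $\mu_{\mathbf v}(\gamma)=\int_0^1|\mathbf v(\dot\gamma(t))|\,dt$. For $x,y\in M$, $d_{M,\mathbf v}(x,y)=\inf_\gamma\int_0^1|\mathbf v(\dot\gamma(t))|\,dt$ over all piecewise $\mathcal C^1$ curves $\gamma$ in $M$ from $x$ to $y$. *)

theory Defs
  imports "HOL-Analysis.Analysis" "HOL-Complex_Analysis.Complex_Analysis"
begin

text \<open>
  Manifolds are embedded: M is a subset of a Euclidean space, smooth maps between subsets of
  Euclidean spaces are those that extend locally to smooth maps on open sets, and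
  coordinate charts are given by their inverses, that is by local parametrizations from open
  subsets of three-dimensional coordinate space. All local formulas below are for dimension 3.
  All inner products, norms, measures and geodesics on M are those of the metric g; the
  ambient Euclidean metric is used only for topology and differentiation.
\<close>

subsection \<open>Smooth maps, charts, tangent and cotangent spaces\<close>

text \<open>Intended for open U only.\<close>

primrec Ck_on ::
  "nat \<Rightarrow> 'a::euclidean_space set \<Rightarrow> ('a \<Rightarrow> 'b::euclidean_space) \<Rightarrow> bool" where
  "Ck_on 0 U f = continuous_on U f"
| "Ck_on (Suc k) U f =
     ((\<forall>x\<in>U. f differentiable (at x)) \<and>
      (\<forall>h. Ck_on k U (\<lambda>x. frechet_derivative f (at x) h)))"

definition smooth_on ::
  "'a::euclidean_space set \<Rightarrow> ('a \<Rightarrow> 'b::euclidean_space) \<Rightarrow> bool" where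
  "smooth_on S f \<longleftrightarrow>
     (\<forall>x\<in>S. \<exists>U F. open U \<and> x \<in> U \<and> (\<forall>k. Ck_on k U F) \<and> (\<forall>y\<in>S \<inter> U. F y = f y))"

definition diffeo ::
  "'a::euclidean_space set \<Rightarrow> 'b::euclidean_space set \<Rightarrow> ('a \<Rightarrow> 'b) \<Rightarrow> bool" where
  "diffeo A B f \<longleftrightarrow> bij_betw f A B \<and> smooth_on A f \<and> smooth_on B (inv_into A f)"

definition charts :: "'a::euclidean_space set \<Rightarrow> ((real^3 \<Rightarrow> 'a) \<times> (real^3) set) set" where
  "charts M =
     {(\<phi>, W). open W \<and> openin (top_of_set M) (\<phi> ` W) \<and> diffeo W (\<phi> ` W) \<phi>}"

definition tangent_space :: "'a::euclidean_space set \<Rightarrow> 'a \<Rightarrow> 'a set" where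
  "tangent_space M p =
     {u. \<exists>\<gamma> e. e > 0 \<and> (\<forall>t::real. \<bar>t\<bar> < e \<longrightarrow> \<gamma> t \<in> M) \<and> \<gamma> 0 = p \<and>
        (\<gamma> has_vector_derivative u) (at 0)}"

text \<open>A covector at p is a linear functional on the tangent space at p. As a total function on
  the ambient space it is 0 outside the tangent space, which makes it unique.\<close>

definition cotangent_space :: "'a::euclidean_space set \<Rightarrow> 'a \<Rightarrow> ('a \<Rightarrow> real) set" where
  "cotangent_space M p =
     {\<alpha>. (\<forall>u. u \<notin> tangent_space M p \<longrightarrow> \<alpha> u = 0) \<and>
         (\<forall>u\<in>tangent_space M p. \<forall>w\<in>tangent_space M p. \<forall>a b.
            \<alpha> (a *\<^sub>R u + b *\<^sub>R w) = a * \<alpha> u + b * \<alpha> w)}"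

definition partial ::
  "3 \<Rightarrow> (real^3 \<Rightarrow> 'b::euclidean_space) \<Rightarrow> real^3 \<Rightarrow> 'b" where
  "partial i f x = frechet_derivative f (at x) (axis i 1)"

subsection \<open>Riemannian metrics\<close>

definition gram ::
  "('a \<Rightarrow> 'a \<Rightarrow> 'a \<Rightarrow> real) \<Rightarrow> (real^3 \<Rightarrow> 'a::euclidean_space) \<Rightarrow> real^3 \<Rightarrow> real^3^3" where
  "gram g \<phi> x = (\<chi> i j. g (\<phi> x) (partial i \<phi> x) (partial j \<phi> x))"

definition riemannian_metric ::
  "'a::euclidean_space set \<Rightarrow> ('a \<Rightarrow> 'a \<Rightarrow> 'a \<Rightarrow> real) \<Rightarrow> bool" where
  "riemannian_metric M g \<longleftrightarrow>
     (\<forall>p\<in>M. \<forall>u\<in>tangent_space M p. \<forall>w\<in>tangent_space M p. g p u w = g p w u) \<and>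
     (\<forall>p\<in>M. \<forall>u\<in>tangent_space M p. \<forall>w\<in>tangent_space M p. \<forall>y\<in>tangent_space M p. \<forall>a b.
        g p (a *\<^sub>R u + b *\<^sub>R w) y = a * g p u y + b * g p w y) \<and>
     (\<forall>p\<in>M. \<forall>u\<in>tangent_space M p. u \<noteq> 0 \<longrightarrow> g p u u > 0) \<and>
     (\<forall>(\<phi>, W)\<in>charts M. \<forall>i j. smooth_on W (\<lambda>x. gram g \<phi> x $ i $ j))"

text \<open>The measures sqrt (det G) dx of the individual charts agree on overlaps, so the Riemannian
  volume is their least upper bound in the complete lattice of Borel measures.\<close>

definition riem_volume ::
  "'a::euclidean_space set \<Rightarrow> ('a \<Rightarrow> 'a \<Rightarrow> 'a \<Rightarrow> real) \<Rightarrow> 'a measure" where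
  "riem_volume M g =
     (SUP (\<phi>, W)\<in>charts M.
        distr (density (restrict_space lborel W) (\<lambda>x. ennreal (sqrt (det (gram g \<phi> x)))))
          borel \<phi>)"

definition christoffel ::
  "('a \<Rightarrow> 'a \<Rightarrow> 'a \<Rightarrow> real) \<Rightarrow> (real^3 \<Rightarrow> 'a::euclidean_space) \<Rightarrow>
   3 \<Rightarrow> 3 \<Rightarrow> 3 \<Rightarrow> real^3 \<Rightarrow> real" where
  "christoffel g \<phi> k i j x =
     (1 / 2) * (\<Sum>l\<in>UNIV. matrix_inv (gram g \<phi> x) $ k $ l *
        (partial i (\<lambda>y. gram g \<phi> y $ j $ l) x + partial j (\<lambda>y. gram g \<phi> y $ i $ l) x
         - partial l (\<lambda>y. gram g \<phi> y $ i $ j) x))"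

subsection \<open>Curves, distance, geodesics, injectivity radius\<close>

definition C1_curve :: "real \<Rightarrow> real \<Rightarrow> (real \<Rightarrow> 'a::euclidean_space) \<Rightarrow> bool" where
  "C1_curve a b \<gamma> \<longleftrightarrow>
     (\<exists>D. continuous_on {a..b} D \<and>
        (\<forall>t\<in>{a..b}. (\<gamma> has_vector_derivative D t) (at t within {a..b})))"

text \<open>Unlike the library's piecewise C1 functions, the pieces here are C1 up to their endpoints.\<close>

definition piecewise_C1_curve :: "(real \<Rightarrow> 'a::euclidean_space) \<Rightarrow> bool" where
  "piecewise_C1_curve \<gamma> \<longleftrightarrow>
     (\<exists>P. finite P \<and> {0, 1} \<subseteq> P \<and> P \<subseteq> {0..1} \<and>
        (\<forall>a\<in>P. \<forall>b\<in>P. a < b \<and> P \<inter> {a<..<b} = {} \<longrightarrow> C1_curve a b \<gamma>))"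

definition curves_from_to ::
  "'a::euclidean_space set \<Rightarrow> 'a \<Rightarrow> 'a \<Rightarrow> (real \<Rightarrow> 'a) set" where
  "curves_from_to M x y =
     {\<gamma>. piecewise_C1_curve \<gamma> \<and> \<gamma> ` {0..1} \<subseteq> M \<and> \<gamma> 0 = x \<and> \<gamma> 1 = y}"

abbreviation velocity :: "(real \<Rightarrow> 'a::euclidean_space) \<Rightarrow> real \<Rightarrow> 'a" where
  "velocity \<gamma> t \<equiv> vector_derivative \<gamma> (at t within {0..1})"

definition riem_dist ::
  "'a::euclidean_space set \<Rightarrow> ('a \<Rightarrow> 'a \<Rightarrow> 'a \<Rightarrow> real) \<Rightarrow> 'a \<Rightarrow> 'a \<Rightarrow> ennreal" where
  "riem_dist M g x y =
     (INF \<gamma>\<in>curves_from_to M x y.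
        \<integral>\<^sup>+t\<in>{0..1}. ennreal (sqrt (g (\<gamma> t) (velocity \<gamma> t) (velocity \<gamma> t))) \<partial>lborel)"

definition riem_ball ::
  "'a::euclidean_space set \<Rightarrow> ('a \<Rightarrow> 'a \<Rightarrow> 'a \<Rightarrow> real) \<Rightarrow> 'a \<Rightarrow> real \<Rightarrow> 'a set" where
  "riem_ball M g x r = {y\<in>M. riem_dist M g x y < ennreal r}"

definition geodesic ::
  "'a::euclidean_space set \<Rightarrow> ('a \<Rightarrow> 'a \<Rightarrow> 'a \<Rightarrow> real) \<Rightarrow>
   real \<Rightarrow> real \<Rightarrow> (real \<Rightarrow> 'a) \<Rightarrow> bool" where
  "geodesic M g a b \<gamma> \<longleftrightarrow>
     smooth_on {a<..<b} \<gamma> \<and> \<gamma> ` {a<..<b} \<subseteq> M \<and>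
     (\<forall>(\<phi>, W)\<in>charts M. \<forall>t\<in>{a<..<b}. \<gamma> t \<in> \<phi> ` W \<longrightarrow>
        (let c = (\<lambda>k s. inv_into W \<phi> (\<gamma> s) $ k) in
         \<forall>k. deriv (deriv (c k)) t
           + (\<Sum>i\<in>UNIV. \<Sum>j\<in>UNIV. christoffel g \<phi> k i j (inv_into W \<phi> (\<gamma> t))
                * deriv (c i) t * deriv (c j) t) = 0))"

definition exp_graph ::
  "'a::euclidean_space set \<Rightarrow> ('a \<Rightarrow> 'a \<Rightarrow> 'a \<Rightarrow> real) \<Rightarrow> 'a \<Rightarrow> 'a \<Rightarrow> 'a \<Rightarrow> bool" where
  "exp_graph M g x u y \<longleftrightarrow>
     (\<exists>a b \<gamma>. a < 0 \<and> 1 < b \<and> geodesic M g a b \<gamma> \<and> \<gamma> 0 = x \<and>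
        (\<gamma> has_vector_derivative u) (at 0) \<and> \<gamma> 1 = y)"

definition riem_exp ::
  "'a::euclidean_space set \<Rightarrow> ('a \<Rightarrow> 'a \<Rightarrow> 'a \<Rightarrow> real) \<Rightarrow> 'a \<Rightarrow> 'a \<Rightarrow> 'a" where
  "riem_exp M g x u = (THE y. exp_graph M g x u y)"

definition tangent_ball ::
  "'a::euclidean_space set \<Rightarrow> ('a \<Rightarrow> 'a \<Rightarrow> 'a \<Rightarrow> real) \<Rightarrow> 'a \<Rightarrow> real \<Rightarrow> 'a set" where
  "tangent_ball M g x r = {u\<in>tangent_space M x. sqrt (g x u u) < r}"

definition inj_radius ::
  "'a::euclidean_space set \<Rightarrow> ('a \<Rightarrow> 'a \<Rightarrow> 'a \<Rightarrow> real) \<Rightarrow> 'a \<Rightarrow> ennreal" where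
  "inj_radius M g x =
     Sup {ennreal r | r. r > 0 \<and>
        (\<forall>u\<in>tangent_ball M g x r. \<exists>y. exp_graph M g x u y) \<and>
        diffeo (tangent_ball M g x r) (riem_exp M g x ` tangent_ball M g x r) (riem_exp M g x)}"

subsection \<open>Differential 1-forms\<close>

definition coeff ::
  "(real^3 \<Rightarrow> 'a::euclidean_space) \<Rightarrow> ('a \<Rightarrow> 'a \<Rightarrow> real) \<Rightarrow> 3 \<Rightarrow> real^3 \<Rightarrow> real" where
  "coeff \<phi> v i x = v (\<phi> x) (partial i \<phi> x)"

text \<open>In this section U is an open subset of the manifold, so that the charts of U are the charts
  of the manifold with image contained in U, and the tangent spaces are the same.\<close>

definition smooth_1form :: "'a::euclidean_space set \<Rightarrow> ('a \<Rightarrow> 'a \<Rightarrow> real) \<Rightarrow> bool" where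
  "smooth_1form U v \<longleftrightarrow>
     (\<forall>p\<in>U. v p \<in> cotangent_space U p) \<and>
     (\<forall>(\<phi>, W)\<in>charts U. \<forall>i. smooth_on W (coeff \<phi> v i))"

definition closed_1form :: "'a::euclidean_space set \<Rightarrow> ('a \<Rightarrow> 'a \<Rightarrow> real) \<Rightarrow> bool" where
  "closed_1form U v \<longleftrightarrow>
     (\<forall>(\<phi>, W)\<in>charts U. \<forall>x\<in>W. \<forall>i j. partial i (coeff \<phi> v j) x - partial j (coeff \<phi> v i) x = 0)"

definition codiff ::
  "('a \<Rightarrow> 'a \<Rightarrow> 'a \<Rightarrow> real) \<Rightarrow> (real^3 \<Rightarrow> 'a::euclidean_space) \<Rightarrow>
   ('a \<Rightarrow> 'a \<Rightarrow> real) \<Rightarrow> real^3 \<Rightarrow> real" where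
  "codiff g \<phi> v x =
     - (1 / sqrt (det (gram g \<phi> x))) *
       (\<Sum>i\<in>UNIV. partial i (\<lambda>y. sqrt (det (gram g \<phi> y)) *
          (\<Sum>j\<in>UNIV. matrix_inv (gram g \<phi> y) $ i $ j * coeff \<phi> v j y)) x)"

definition coclosed_1form ::
  "'a::euclidean_space set \<Rightarrow> ('a \<Rightarrow> 'a \<Rightarrow> 'a \<Rightarrow> real) \<Rightarrow> ('a \<Rightarrow> 'a \<Rightarrow> real) \<Rightarrow> bool" where
  "coclosed_1form U g v \<longleftrightarrow> (\<forall>(\<phi>, W)\<in>charts U. \<forall>x\<in>W. codiff g \<phi> v x = 0)"

definition norm_sq ::
  "('a \<Rightarrow> 'a \<Rightarrow> 'a \<Rightarrow> real) \<Rightarrow> (real^3 \<Rightarrow> 'a::euclidean_space) \<Rightarrow>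
   ('a \<Rightarrow> 'a \<Rightarrow> real) \<Rightarrow> real^3 \<Rightarrow> real" where
  "norm_sq g \<phi> v x =
     (\<Sum>i\<in>UNIV. \<Sum>j\<in>UNIV. matrix_inv (gram g \<phi> x) $ i $ j * coeff \<phi> v i x * coeff \<phi> v j x)"

definition cov_deriv ::
  "('a \<Rightarrow> 'a \<Rightarrow> 'a \<Rightarrow> real) \<Rightarrow> (real^3 \<Rightarrow> 'a::euclidean_space) \<Rightarrow>
   ('a \<Rightarrow> 'a \<Rightarrow> real) \<Rightarrow> 3 \<Rightarrow> 3 \<Rightarrow> real^3 \<Rightarrow> real" where
  "cov_deriv g \<phi> v i j x =
     partial i (coeff \<phi> v j) x - (\<Sum>k\<in>UNIV. christoffel g \<phi> k i j x * coeff \<phi> v k x)"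

definition cov_deriv_norm_sq ::
  "('a \<Rightarrow> 'a \<Rightarrow> 'a \<Rightarrow> real) \<Rightarrow> (real^3 \<Rightarrow> 'a::euclidean_space) \<Rightarrow>
   ('a \<Rightarrow> 'a \<Rightarrow> real) \<Rightarrow> real^3 \<Rightarrow> real" where
  "cov_deriv_norm_sq g \<phi> v x =
     (\<Sum>i\<in>UNIV. \<Sum>j\<in>UNIV. \<Sum>k\<in>UNIV. \<Sum>l\<in>UNIV.
        matrix_inv (gram g \<phi> x) $ i $ k * matrix_inv (gram g \<phi> x) $ j $ l *
        cov_deriv g \<phi> v i j x * cov_deriv g \<phi> v k l x)"

subsection \<open>Two-valued 1-forms and Z/2 harmonic 1-forms\<close>

text \<open>A two-valued 1-form assigns to a point the set of its values, plus and minus a covector. Only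
  its values off the zero locus Z are data; on Z it is set to 0.\<close>

definition section_on ::
  "'a::euclidean_space set \<Rightarrow> ('a \<Rightarrow> ('a \<Rightarrow> real) set) \<Rightarrow> ('a \<Rightarrow> 'a \<Rightarrow> real) \<Rightarrow> bool" where
  "section_on U V v \<longleftrightarrow> smooth_1form U v \<and> (\<forall>p\<in>U. V p = {v p, (\<lambda>u. - v p u)})"

definition zero_ext ::
  "'a set \<Rightarrow> ('a \<Rightarrow> ('a \<Rightarrow> real) set) \<Rightarrow> 'a \<Rightarrow> ('a \<Rightarrow> real) set" where
  "zero_ext Z V p = (if p \<in> Z then {\<lambda>u. 0} else V p)"

definition abs_val ::
  "'a set \<Rightarrow> ('a \<Rightarrow> ('a \<Rightarrow> real) set) \<Rightarrow> 'a \<Rightarrow> 'a \<Rightarrow> real" where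
  "abs_val Z V p u = (THE c. \<exists>\<alpha>\<in>zero_ext Z V p. c = \<bar>\<alpha> u\<bar>)"

text \<open>Evaluation at p of a chart-independent and sign-independent local expression Q; Q is
  norm_sq or cov_deriv_norm_sq.\<close>

definition local_value ::
  "'a::euclidean_space set \<Rightarrow> 'a set \<Rightarrow> ('a \<Rightarrow> ('a \<Rightarrow> real) set) \<Rightarrow>
   ((real^3 \<Rightarrow> 'a) \<Rightarrow> ('a \<Rightarrow> 'a \<Rightarrow> real) \<Rightarrow> real^3 \<Rightarrow> real) \<Rightarrow> 'a \<Rightarrow> real" where
  "local_value M Z V Q p =
     (if p \<in> Z then 0
      else (THE c. \<exists>\<phi> W v x. (\<phi>, W) \<in> charts (M - Z) \<and> section_on (\<phi> ` W) V v \<and>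
              x \<in> W \<and> \<phi> x = p \<and> c = Q \<phi> v x))"

definition z2_harmonic ::
  "'a::euclidean_space set \<Rightarrow> ('a \<Rightarrow> 'a \<Rightarrow> 'a \<Rightarrow> real) \<Rightarrow>
   'a set \<Rightarrow> ('a \<Rightarrow> ('a \<Rightarrow> real) set) \<Rightarrow> bool" where
  "z2_harmonic M g Z V \<longleftrightarrow>
     closedin (top_of_set M) Z \<and> Z \<noteq> M \<and>
     (\<forall>p\<in>M - Z. \<exists>U v. openin (top_of_set M) U \<and> p \<in> U \<and> U \<subseteq> M - Z \<and>
        section_on U V v \<and> (\<forall>q\<in>U. v q \<noteq> (\<lambda>u. 0)) \<and> closed_1form U v \<and> coclosed_1form U g v) \<and>
     (\<forall>U. openin (top_of_set M) U \<and> compact (M \<inter> closure U) \<longrightarrow>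
        (\<integral>\<^sup>+p\<in>U - Z. ennreal (local_value M Z V (norm_sq g) p) \<partial>riem_volume M g) < \<infinity> \<and>
        (\<integral>\<^sup>+p\<in>U - Z. ennreal (local_value M Z V (cov_deriv_norm_sq g) p) \<partial>riem_volume M g) < \<infinity>) \<and>
     (\<exists>C \<epsilon>::real. \<epsilon> > 0 \<and>
        (\<forall>x\<in>Z. \<forall>r. 0 < r \<and> r < 1 \<and> ennreal r < inj_radius M g x \<longrightarrow>
           (\<integral>\<^sup>+p\<in>riem_ball M g x r. ennreal (local_value M Z V (norm_sq g) p) \<partial>riem_volume M g)
             < ennreal (C * r powr (3 + \<epsilon>))))"

subsection \<open>Cylindrical points, transverse arcs\<close>

text \<open>The values at x of the two-valued form Re (d sqrt (z^k)), z = x1 + i x2, with s ranging over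
  the local branches of the square root of z^k. For k at least 3 it extends by 0 to z = 0.\<close>

definition Re_d_sqrt_pow :: "nat \<Rightarrow> real^3 \<Rightarrow> (real^3 \<Rightarrow> real) set" where
  "Re_d_sqrt_pow k x =
     (let z = Complex (x $ 1) (x $ 2) in
      if z = 0 then {\<lambda>h. 0}
      else {(\<lambda>h. Re (deriv s z * Complex (h $ 1) (h $ 2))) | s.
              \<exists>N. open N \<and> z \<in> N \<and> s holomorphic_on N \<and> (\<forall>w\<in>N. s w ^ 2 = w ^ k)})"

definition cylindrical ::
  "'a::euclidean_space set \<Rightarrow> 'a set \<Rightarrow> ('a \<Rightarrow> ('a \<Rightarrow> real) set) \<Rightarrow> 'a \<Rightarrow> bool" where
  "cylindrical M Z V p \<longleftrightarrow>
     (\<exists>\<phi> W (f :: real^3 \<Rightarrow> real) k. (\<phi>, W) \<in> charts M \<and> p \<in> \<phi> ` W \<and>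
        smooth_on W f \<and> (\<forall>x\<in>W. f x \<noteq> 0) \<and> 3 \<le> k \<and>
        (\<forall>x\<in>W. (\<lambda>\<alpha> h. \<alpha> (frechet_derivative \<phi> (at x) h)) ` zero_ext Z V (\<phi> x)
              = (\<lambda>\<beta> h. f x * \<beta> h) ` Re_d_sqrt_pow k x))"

definition mu :: "'a::euclidean_space set \<Rightarrow> ('a \<Rightarrow> ('a \<Rightarrow> real) set) \<Rightarrow> (real \<Rightarrow> 'a) \<Rightarrow> ennreal" where
  "mu Z V \<gamma> = (\<integral>\<^sup>+t\<in>{0..1}. ennreal (abs_val Z V (\<gamma> t) (velocity \<gamma> t)) \<partial>lborel)"

definition form_dist ::
  "'a::euclidean_space set \<Rightarrow> 'a set \<Rightarrow> ('a \<Rightarrow> ('a \<Rightarrow> real) set) \<Rightarrow> 'a \<Rightarrow> 'a \<Rightarrow> ennreal" where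
  "form_dist M Z V x y = (INF \<gamma>\<in>curves_from_to M x y. mu Z V \<gamma>)"

definition ker :: "'a::euclidean_space set \<Rightarrow> ('a \<Rightarrow> ('a \<Rightarrow> real) set) \<Rightarrow> 'a \<Rightarrow> 'a set" where
  "ker M V p = {u\<in>tangent_space M p. \<forall>\<alpha>\<in>V p. \<alpha> u = 0}"

text \<open>The foliation has codimension one, so a curve is transverse to it when its velocity is
  nowhere tangent to a leaf.\<close>

definition transverse_arc ::
  "'a::euclidean_space set \<Rightarrow> 'a set \<Rightarrow> ('a \<Rightarrow> ('a \<Rightarrow> real) set) \<Rightarrow> (real \<Rightarrow> 'a) \<Rightarrow> bool" where
  "transverse_arc M Z V \<gamma> \<longleftrightarrow>
     C1_curve 0 1 \<gamma> \<and> \<gamma> ` {0..1} \<subseteq> M - Z \<and> (\<forall>t\<in>{0..1}. velocity \<gamma> t \<notin> ker M V (\<gamma> t))"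

abbreviation S3 :: "(real^4) set" where
  "S3 \<equiv> sphere 0 1"

end

(*
  Only the compactness of the sphere matters. The pseudo-distance of v is bounded: |v| is locally
  bounded with respect to the ambient norm, so great arcs have uniformly bounded v-length. On the other
  hand every transverse arc can be prolonged by a definite amount. Off Z one turns its velocity towards a
  fixed direction on which v is positive and goes straight in a chart. Near a cylindrical point one uses
  the coordinate u = z^(k/2) on a branch where v = f * Re du with Re du positive on the arc, and goes
  straight in one of the directions 1 + i and 1 - i; at least one of these rays avoids u = 0, so the
  arc passes by Z. By compactness the gain is bounded below, hence there are transverse arcs of arbitrarily
  large v-length, and these cannot all realize the pseudo-distance of their endpoints.
*)

theory Submission
  imports Defs
begin

subsection \<open>Calculus of Ck maps and charts of the sphere\<close>

text \<open>The obstacle to a uniform gain is the end velocity of the arc. The prolongation has to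
  be C1, so it must start with that velocity, which may be nearly tangent to the foliation or very
  long, and no fixed turning time suits all velocities. The turning time is therefore chosen after
  the velocity, and the gain is collected only on the straight piece after the turn, where it is
  bounded below by data of the chart alone. The turn stays transverse because the vectors on which a
  covector is positive form a convex cone. \<open>V\<close> need not have a global sign. Lengths are
  measured by \<open>abs_val\<close>, and a local sign is picked anew for each prolongation,
  according to the velocity. One constant \<delta> serves both sides: the form is at most
  \<open>1 / \<delta>\<close> times the ambient norm, which makes \<open>pi / \<delta>\<close> a
  bound for all distances, and \<delta> is also the gain of one prolongation. The contradiction
  comes after more than \<open>pi / \<delta>^2\<close> prolongations.\<close>

lemma Ck_on_cong:
  assumes "open U" "\<And>x. x \<in> U \<Longrightarrow> f x = g x" "Ck_on k U f"
  shows "Ck_on k U g"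
  using assms(2,3)
proof (induction k arbitrary: f g)
  case 0
  then show ?case by (simp cong: continuous_on_cong)
next
  case (Suc k)
  \<comment> \<open>\<open>frechet_derivative\<close> is a choice among all derivatives, so two
    functions with the same derivatives receive the same choice.\<close>
  have der: "(f has_derivative F) (at x) \<longleftrightarrow> (g has_derivative F) (at x)" if "x \<in> U" for x F
    using has_derivative_transform_within_open[OF _ assms(1) that, of f F UNIV g]
      has_derivative_transform_within_open[OF _ assms(1) that, of g F UNIV f] Suc.prems(1) by auto
  have "frechet_derivative f (at x) = frechet_derivative g (at x)" if "x \<in> U" for x
    using der[OF that] by (simp add: frechet_derivative_def)
  moreover have "g differentiable (at x)" if "x \<in> U" for x
    using Suc.prems(2) that unfolding Ck_on.simps differentiable_def der[OF that, symmetric] by blast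
  moreover have "Ck_on k U (\<lambda>x. frechet_derivative g (at x) h)" for h
    by (rule Suc.IH[of "\<lambda>x. frechet_derivative f (at x) h"]) (use Suc.prems calculation in auto)
  ultimately show ?case by simp
qed

lemma Ck_on_SucI:
  assumes "open U" "\<And>x. x \<in> U \<Longrightarrow> (f has_derivative F x) (at x)"
    "\<And>h. Ck_on k U (\<lambda>x. F x h)"
  shows "Ck_on (Suc k) U f"
proof -
  have "F x = frechet_derivative f (at x)" if "x \<in> U" for x
    using frechet_derivative_at[OF assms(2)[OF that]] .
  then have "Ck_on k U (\<lambda>x. frechet_derivative f (at x) h)" for h
    using Ck_on_cong[OF assms(1) _ assms(3)] by simp
  then show ?thesis using assms(2) by (auto simp: differentiable_def)
qed

lemma Ck_on_const: "open U \<Longrightarrow> Ck_on k U (\<lambda>x. c)"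
proof (induction k arbitrary: c)
  case (Suc k)
  then show ?case by (intro Ck_on_SucI[where F = "\<lambda>x h. 0"]) auto
qed simp

lemma Ck_on_linear: "open U \<Longrightarrow> bounded_linear f \<Longrightarrow> Ck_on k U f"
proof (cases k)
  case (Suc n)
  assume "open U" "bounded_linear f"
  then show ?thesis unfolding Suc
    by (intro Ck_on_SucI[where F = "\<lambda>x. f"] bounded_linear_imp_has_derivative Ck_on_const)
qed (simp add: linear_continuous_on)

lemma Ck_on_SucD: "Ck_on (Suc k) U f \<Longrightarrow> Ck_on k U f"
proof (induction k arbitrary: f)
  case 0
  then show ?case
    by (auto intro!: continuous_at_imp_continuous_on differentiable_imp_continuous_within)
next
  case (Suc k)
  then show ?case using Ck_on.simps(2) by blast
qed

lemma Ck_on_has_derivative: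
  "Ck_on (Suc k) U f \<Longrightarrow> x \<in> U \<Longrightarrow> (f has_derivative frechet_derivative f (at x)) (at x)"
  by (simp add: frechet_derivative_works)

lemma Ck_on_add:
  assumes "open U" "Ck_on k U f" "Ck_on k U g"
  shows "Ck_on k U (\<lambda>x. f x + g x)"
  using assms(2,3)
proof (induction k arbitrary: f g)
  case (Suc k)
  show ?case
    by (rule Ck_on_SucI[OF assms(1) has_derivative_add[OF Ck_on_has_derivative[OF Suc.prems(1)]
            Ck_on_has_derivative[OF Suc.prems(2)]]])
      (use Suc in auto)
qed (simp add: continuous_on_add)

lemma Ck_on_scaleR:
  fixes f :: "'a::euclidean_space \<Rightarrow> real"
  assumes "open U" "Ck_on k U f" "Ck_on k U g"
  shows "Ck_on k U (\<lambda>x. f x *\<^sub>R g x)"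
  using assms(2,3)
proof (induction k arbitrary: f g)
  case (Suc k)
  show ?case
    by (rule Ck_on_SucI[OF assms(1) has_derivative_scaleR[OF Ck_on_has_derivative[OF Suc.prems(1)]
            Ck_on_has_derivative[OF Suc.prems(2)]]])
      (use Suc Ck_on_SucD[OF Suc.prems(1)] Ck_on_SucD[OF Suc.prems(2)] in
        \<open>auto intro!: Ck_on_add[OF assms(1)] Suc.IH\<close>)
qed (simp add: continuous_on_scaleR)

text \<open>Differentiation lowers the exponent by one, so the induction runs over all real
  exponents \<open>a\<close>; the base stays positive in the open ball. The case
  \<open>a = 1/2\<close> is the height of a hemisphere over its equatorial ball.\<close>

lemma Ck_on_powr_ball:
  "Ck_on k (ball 0 1) (\<lambda>x::'a::euclidean_space. (1 - x \<bullet> x) powr a)"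
proof (induction k arbitrary: a)
  case 0
  have "1 - x \<bullet> x \<noteq> 0" if "x \<in> ball 0 1" for x :: 'a
    using that by (auto simp: norm_eq_sqrt_inner)
  then show ?case by (auto intro!: continuous_intros)
next
  case (Suc k)
  have "1 - x \<bullet> x > 0" if "x \<in> ball 0 1" for x :: 'a
    using that by (auto simp: norm_eq_sqrt_inner)
  then have "((\<lambda>x::'a. (1 - x \<bullet> x) powr a) has_derivative
      (\<lambda>h. (1 - x \<bullet> x) powr (a - 1) *\<^sub>R ((- 2 * a) * (x \<bullet> h)))) (at x)" if "x \<in> ball 0 1" for x
    using that
    by (auto intro!: derivative_eq_intros simp: inner_commute powr_diff field_simps abs_of_pos)
  moreover have "Ck_on k (ball 0 1) (\<lambda>x::'a. (1 - x \<bullet> x) powr (a - 1) *\<^sub>R ((- 2 * a) * (x \<bullet> h)))" for h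
    by (intro Ck_on_scaleR Suc Ck_on_linear open_ball bounded_linear_const_mult bounded_linear_inner_left)
  ultimately show ?case by (rule Ck_on_SucI[OF open_ball])
qed

section \<open>Hemispheres as graphs\<close>

lemma smooth_onI: "open U \<Longrightarrow> S \<subseteq> U \<Longrightarrow> (\<And>k. Ck_on k U f) \<Longrightarrow> smooth_on S f"
  unfolding smooth_on_def by blast

text \<open>The open hemisphere centred at \<open>q\<close> is a graph over the unit ball of the
  hyperplane orthogonal to \<open>q\<close>, and a linear isometry identifies that hyperplane with
  the coordinate space.\<close>

lemma hemisphere_chart:
  fixes q :: "real^4"
  assumes "norm q = 1"
  obtains \<phi> :: "real^3 \<Rightarrow> real^4" where "(\<phi>, ball 0 1) \<in> charts S3" "\<phi> 0 = q"
proof -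
  define T where "T = {x::real^4. q \<bullet> x = 0}"
  have "subspace T" "dim T = dim (UNIV :: (real^3) set)"
    using assms dim_hyperplane[of q] norm_zero[where 'a = "real^4"]
    by (fastforce simp: T_def subspace_hyperplane)+
  then obtain B B' where B: "linear B" "linear B'" "B ` (UNIV :: (real^3) set) = T"
      "\<And>x. norm (B x) = norm x" "\<And>x. B' (B x) = x" "\<And>y. y \<in> T \<Longrightarrow> norm (B' y) = norm y"
      "\<And>y. y \<in> T \<Longrightarrow> B (B' y) = y"
    using isometries_subspaces[of "UNIV :: (real^3) set" T] by (metis UNIV_I subspace_UNIV)
  have qq: "q \<bullet> q = 1" using assms by (simp add: norm_eq_1)
  have qB: "q \<bullet> B x = 0" "B x \<bullet> q = 0" for x using B(3) by (auto simp: T_def inner_commute)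
  define \<phi> where "\<phi> x = B x + (1 - x \<bullet> x) powr (1/2) *\<^sub>R q" for x
  \<comment> \<open>Orthogonal projection along \<open>q\<close>. Being linear on the whole ambient
    space, it is the smooth extension of the inverse chart that \<open>smooth_on\<close> asks
    for.\<close>
  define \<psi> where "\<psi> p = B' (p - (q \<bullet> p) *\<^sub>R q)" for p
  have pos: "1 - x \<bullet> x > 0" if "x \<in> ball 0 1" for x :: "real^3"
    using that by (auto simp: norm_eq_sqrt_inner)
  have q\<phi>: "q \<bullet> \<phi> x = (1 - x \<bullet> x) powr (1/2)" for x
    by (simp add: \<phi>_def inner_add_right qB qq)
  have \<psi>\<phi>: "\<psi> (\<phi> x) = x" for x
    unfolding \<psi>_def q\<phi> by (simp add: \<phi>_def B)
  have norm\<phi>: "norm (\<phi> x) = 1" if "x \<in> ball 0 1" for x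
  proof -
    have "\<phi> x \<bullet> \<phi> x = B x \<bullet> B x + ((1 - x \<bullet> x) powr (1/2))\<^sup>2"
      unfolding \<phi>_def by (simp add: inner_add_left inner_add_right qB qq power2_eq_square)
    also have "B x \<bullet> B x = x \<bullet> x" using B(4)[of x] by (simp only: norm_eq)
    also have "x \<bullet> x + ((1 - x \<bullet> x) powr (1/2))\<^sup>2 = 1"
      using pos[OF that] by (simp add: powr_half_sqrt)
    finally show ?thesis by (simp add: norm_eq_1)
  qed
  have inv: "\<psi> p \<in> ball 0 1 \<and> \<phi> (\<psi> p) = p" if "p \<in> S3" "q \<bullet> p > 0" for p
  proof -
    define y where "y = p - (q \<bullet> p) *\<^sub>R q"
    have yT: "y \<in> T" by (simp add: T_def y_def inner_diff_right qq)
    have "p \<bullet> p = 1" using that(1) by (simp add: norm_eq_1)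
    then have "y \<bullet> y = 1 - (q \<bullet> p)\<^sup>2"
      by (simp add: y_def inner_diff_left inner_diff_right qq inner_commute[of p q] power2_eq_square)
    moreover have "\<psi> p \<bullet> \<psi> p = y \<bullet> y"
      using B(6)[OF yT] unfolding \<psi>_def y_def[symmetric] by (simp only: norm_eq)
    ultimately have *: "\<psi> p \<bullet> \<psi> p = 1 - (q \<bullet> p)\<^sup>2" by simp
    then have "\<psi> p \<bullet> \<psi> p < 1" using that(2) by simp
    then have "\<psi> p \<in> ball 0 1" by (simp add: norm_eq_sqrt_inner)
    moreover have "B (\<psi> p) = y" using B(7)[OF yT] by (simp add: \<psi>_def y_def)
    then have "\<phi> (\<psi> p) = p"
      using that(2) by (simp add: \<phi>_def * powr_half_sqrt y_def)
    ultimately show ?thesis by simp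
  qed
  have image: "\<phi> ` ball 0 1 = S3 \<inter> {p. q \<bullet> p > 0}"
  proof (intro set_eqI iffI)
    fix p assume "p \<in> \<phi> ` ball 0 1"
    then show "p \<in> S3 \<inter> {p. q \<bullet> p > 0}" using norm\<phi> q\<phi> pos by (force)
  next
    fix p assume "p \<in> S3 \<inter> {p. q \<bullet> p > 0}"
    then show "p \<in> \<phi> ` ball 0 1" using inv[of p] by (metis IntD1 IntD2 image_eqI mem_Collect_eq)
  qed
  have "open {p. q \<bullet> p > 0}" by (simp add: open_halfspace_gt)
  then have openin: "openin (top_of_set S3) (\<phi> ` ball 0 1)"
    unfolding image by (simp add: openin_open_Int)
  have inj: "inj_on \<phi> (ball 0 1)" by (metis \<psi>\<phi> inj_onI)
  have "Ck_on k (ball 0 1) \<phi>" for k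
    unfolding \<phi>_def
    by (intro Ck_on_add Ck_on_scaleR Ck_on_linear Ck_on_const Ck_on_powr_ball open_ball
        linear_conv_bounded_linear[THEN iffD1] B)
  then have "smooth_on (ball 0 1) \<phi>" by (intro smooth_onI[of "ball 0 1"]) auto
  moreover have "linear \<psi>" unfolding \<psi>_def
    using linear_compose[OF _ B(2), of "\<lambda>p. p - (q \<bullet> p) *\<^sub>R q"]
    by (simp add: o_def linear_iff inner_add_right algebra_simps)
  then have "Ck_on k UNIV \<psi>" for k
    by (intro Ck_on_linear open_UNIV) (simp add: linear_conv_bounded_linear)
  then have "smooth_on (\<phi> ` ball 0 1) (inv_into (ball 0 1) \<phi>)"
    unfolding smooth_on_def using inv_into_f_f[OF inj] \<psi>\<phi>
    by (intro ballI exI[of _ UNIV] exI[of _ \<psi>]) auto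
  ultimately have "diffeo (ball 0 1) (\<phi> ` ball 0 1) \<phi>"
    unfolding diffeo_def using inj by (simp add: inj_on_imp_bij_betw)
  then have "(\<phi>, ball 0 1) \<in> charts S3" using openin by (simp add: charts_def)
  moreover have "\<phi> 0 = q" using linear_0[OF B(1)] by (simp add: \<phi>_def)
  ultimately show thesis using that by blast
qed

subsection \<open>Charts and tangent vectors\<close>

lemma smooth_onE:
  assumes "smooth_on S f" "x \<in> S"
  obtains U F where "open U" "x \<in> U" "\<And>k. Ck_on k U F" "\<And>y. y \<in> S \<inter> U \<Longrightarrow> F y = f y"
proof -
  obtain U F where "open U \<and> x \<in> U \<and> (\<forall>k. Ck_on k U F) \<and> (\<forall>y\<in>S \<inter> U. F y = f y)"
    using bspec[OF assms[unfolded smooth_on_def]] by (elim exE)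
  then show thesis by (intro that[of U F]) auto
qed

lemma smooth_on_subset_cong:
  assumes "smooth_on S f" "T \<subseteq> S" "\<And>y. y \<in> T \<Longrightarrow> g y = f y"
  shows "smooth_on T g"
  unfolding smooth_on_def
proof
  fix x assume "x \<in> T"
  then obtain U F where "open U" "x \<in> U" "\<And>k. Ck_on k U F" "\<And>y. y \<in> S \<inter> U \<Longrightarrow> F y = f y"
    using smooth_onE[OF assms(1)] assms(2) by (metis subsetD)
  then show "\<exists>U F. open U \<and> x \<in> U \<and> (\<forall>k. Ck_on k U F) \<and> (\<forall>y\<in>T \<inter> U. F y = g y)"
    using assms(2,3) by (intro exI[of _ U] exI[of _ F]) auto
qed

lemma smooth_on_has_derivative:
  assumes "open W" "smooth_on W f" "x \<in> W"
  shows "(f has_derivative frechet_derivative f (at x)) (at x)"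
proof -
  obtain U F where U: "open U" "x \<in> U" "\<And>k. Ck_on k U F" "\<And>y. y \<in> W \<inter> U \<Longrightarrow> F y = f y"
    using smooth_onE[OF assms(2)] assms(3) by metis
  have "(F has_derivative frechet_derivative F (at x)) (at x)"
    using Ck_on_has_derivative[OF U(3,2)] .
  then have "(f has_derivative frechet_derivative F (at x)) (at x)"
    by (rule has_derivative_transform_within_open[of _ _ _ _ "W \<inter> U"]) (use U assms in auto)
  then show ?thesis by (metis frechet_derivative_at)
qed

lemma smooth_on_continuous_derivative:
  assumes "open W" "smooth_on W f"
  shows "continuous_on W (\<lambda>x. frechet_derivative f (at x) h)"
proof (rule continuous_at_imp_continuous_on, rule ballI)
  fix x assume "x \<in> W"
  then obtain U F where U: "open U" "x \<in> U" "\<And>k. Ck_on k U F" "\<And>y. y \<in> W \<inter> U \<Longrightarrow> F y = f y"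
    using smooth_onE[OF assms(2)] by metis
  have "Ck_on 1 (W \<inter> U) f"
  proof (rule Ck_on_cong[of _ F])
    show "Ck_on 1 (W \<inter> U) F" using U(3)[of 1] by (auto intro: continuous_on_subset)
  qed (use U assms in auto)
  then have "continuous_on (W \<inter> U) (\<lambda>x. frechet_derivative f (at x) h)" by simp
  then show "isCont (\<lambda>x. frechet_derivative f (at x) h) x"
    using U assms \<open>x \<in> W\<close> by (simp add: continuous_on_eq_continuous_at open_Int)
qed

lemma smooth_on_continuous_on: 
  assumes "smooth_on W f" shows "continuous_on W f"
  unfolding continuous_on_eq_continuous_within
proof
  fix x assume "x \<in> W"
  then obtain U F where U: "open U" "x \<in> U" "\<And>k. Ck_on k U F" "\<And>y. y \<in> W \<inter> U \<Longrightarrow> F y = f y"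
    using smooth_onE[OF assms] by metis
  have "isCont F x" using U(3)[of 0] U(1,2) by (simp add: continuous_on_eq_continuous_at)
  then have "continuous (at x within W) F" by (rule continuous_at_imp_continuous_at_within)
  then have "continuous (at x within W \<inter> U) F" by (rule continuous_within_subset) simp
  then have "continuous (at x within W \<inter> U) f"
    using U \<open>x \<in> W\<close>
    by (auto intro: continuous_transform_within[of _ _ _ 1])
  moreover have "at x within W = at x within (W \<inter> U)"
    using U by (intro at_within_nhd[of x U]) auto
  ultimately show "continuous (at x within W) f" by (simp only: continuous_within)
qed

section \<open>Restriction of charts and lifting of tangent vectors\<close>

lemma chart_open_subset:
  assumes "(\<phi>, W) \<in> charts M" "open W'" "W' \<subseteq> W"
  shows "(\<phi>, W') \<in> charts M"
proof -
  have W: "open W" "openin (top_of_set M) (\<phi> ` W)" "bij_betw \<phi> W (\<phi> ` W)" "smooth_on W \<phi>"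
    "smooth_on (\<phi> ` W) (inv_into W \<phi>)"
    using assms by (auto simp: charts_def diffeo_def)
  have inj: "inj_on \<phi> W" "inj_on \<phi> W'" using W(3) assms(3) by (auto simp: bij_betw_def inj_on_subset)
  have "\<phi> ` W' = \<phi> ` W \<inter> inv_into W \<phi> -` W'"
    using assms(3) inj(1) by (force simp: inv_into_f_f)
  then have "openin (top_of_set (\<phi> ` W)) (\<phi> ` W')"
    using continuous_openin_preimage_gen[OF smooth_on_continuous_on[OF W(5)] assms(2)] by simp
  then have "openin (top_of_set M) (\<phi> ` W')" using W(2) openin_trans by blast
  moreover have "smooth_on W' \<phi>" using smooth_on_subset_cong[OF W(4) assms(3)] by blast
  moreover have "inv_into W' \<phi> y = inv_into W \<phi> y" if "y \<in> \<phi> ` W'" for y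
    using that inj assms(3) by (force simp: inv_into_f_f)
  then have "smooth_on (\<phi> ` W') (inv_into W' \<phi>)"
    by (rule smooth_on_subset_cong[OF W(5) image_mono[OF assms(3)]])
  ultimately show ?thesis using assms(2) inj(2) by (simp add: charts_def diffeo_def inj_on_imp_bij_betw)
qed

text \<open>Forms on \<open>U\<close> are tested in charts of \<open>U\<close>, while tangent
  vectors and curves refer to \<open>M\<close>; a sufficiently small domain serves both.\<close>

lemma chart_restrict:
  assumes "(\<phi>, W) \<in> charts M" "openin (top_of_set M) U" "\<phi> x \<in> U" "x \<in> W"
  obtains W' where "W' \<subseteq> W" "x \<in> W'" "(\<phi>, W') \<in> charts M" "(\<phi>, W') \<in> charts U"
proof -
  have W: "open W" "openin (top_of_set M) (\<phi> ` W)" "smooth_on W \<phi>"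
    using assms by (auto simp: charts_def diffeo_def)
  obtain N where N: "open N" "U = M \<inter> N" using assms(2) by (auto simp: openin_open)
  define W' where "W' = W \<inter> \<phi> -` N"
  have "open W'" unfolding W'_def
    using continuous_open_preimage[OF smooth_on_continuous_on[OF W(3)] W(1) N(1)] .
  then have 1: "(\<phi>, W') \<in> charts M" by (rule chart_open_subset[OF assms(1)]) (simp add: W'_def)
  have "\<phi> ` W' \<subseteq> U" using W(2) openin_imp_subset N by (fastforce simp: W'_def)
  moreover have "openin (top_of_set M) (\<phi> ` W')" using 1 by (auto simp: charts_def)
  ultimately have "openin (top_of_set U) (\<phi> ` W')"
    using assms(2) by (meson openin_imp_subset openin_subset_trans)
  then have "(\<phi>, W') \<in> charts U" using 1 by (simp add: charts_def)
  with 1 show thesis using that[of W'] assms(3,4) N by (auto simp: W'_def)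
qed

lemma chart_has_derivative:
  assumes "(\<phi>, W) \<in> charts M" "x \<in> W"
  shows "(\<phi> has_derivative frechet_derivative \<phi> (at x)) (at x)"
  using assms smooth_on_has_derivative by (auto simp: charts_def diffeo_def)

lemma chart_linear:
  assumes "(\<phi>, W) \<in> charts M" "x \<in> W"
  shows "linear (frechet_derivative \<phi> (at x))"
  using chart_has_derivative[OF assms] has_derivative_linear by blast

lemma chart_subset: "(\<phi>, W) \<in> charts M \<Longrightarrow> \<phi> ` W \<subseteq> M"
  by (auto simp: charts_def dest: openin_imp_subset)

lemma chart_derivative_tangent:
  assumes "(\<phi>, W) \<in> charts M" "x \<in> W"
  shows "frechet_derivative \<phi> (at x) h \<in> tangent_space M (\<phi> x)"
proof -
  have "open W" using assms by (auto simp: charts_def)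
  have "((\<lambda>t. x + t *\<^sub>R h) \<longlongrightarrow> x + 0 *\<^sub>R h) (at (0::real))" by (intro tendsto_intros)
  then have "\<forall>\<^sub>F t in at (0::real). x + t *\<^sub>R h \<in> W"
    using topological_tendstoD[OF _ \<open>open W\<close>] assms(2) by fastforce
  then obtain e where e: "e > 0" "\<And>t. t \<noteq> 0 \<Longrightarrow> \<bar>t\<bar> < e \<Longrightarrow> x + t *\<^sub>R h \<in> W"
    by (auto simp: eventually_at dist_real_def)
  have "x + t *\<^sub>R h \<in> W" if "\<bar>t\<bar> < e" for t using e assms(2) that by (cases "t = 0") auto
  moreover have "((\<lambda>t. \<phi> (x + t *\<^sub>R h)) has_derivative (\<lambda>s. frechet_derivative \<phi> (at x) (s *\<^sub>R h))) (at 0)"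
    by (rule has_derivative_compose[of "\<lambda>t. x + t *\<^sub>R h"])
      (auto intro!: derivative_eq_intros chart_has_derivative[OF assms])
  then have "((\<lambda>t. \<phi> (x + t *\<^sub>R h)) has_vector_derivative frechet_derivative \<phi> (at x) h) (at 0)"
    by (simp add: has_vector_derivative_def linear_scale[OF chart_linear[OF assms]])
  ultimately show ?thesis
    unfolding tangent_space_def using e(1) chart_subset[OF assms(1)] 
    by (intro CollectI exI[of _ "\<lambda>t. \<phi> (x + t *\<^sub>R h)"] exI[of _ e]) auto
qed

lemma tangent_space_mono: "U \<subseteq> M \<Longrightarrow> tangent_space U p \<subseteq> tangent_space M p"
  unfolding tangent_space_def by blast

text \<open>Finitely many basis vectors control a linear map: near \<open>p\<close> each
  \<open>norm (A y b)\<close> stays below \<open>norm (A p b) + 1\<close>, and summing over the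
  basis gives a locally uniform operator bound.\<close>

lemma linear_locally_bounded:
  fixes A :: "'a::t2_space \<Rightarrow> 'b::euclidean_space \<Rightarrow> 'c::real_normed_vector"
  assumes "\<And>y. y \<in> N \<Longrightarrow> linear (A y)" "\<And>h. continuous_on N (\<lambda>y. A y h)" "open N" "p \<in> N"
  obtains K N' where "K > 0" "open N'" "p \<in> N'" "N' \<subseteq> N" "\<And>y h. y \<in> N' \<Longrightarrow> norm (A y h) \<le> K * norm h"
proof -
  define N' where "N' = N \<inter> (\<Inter>b\<in>Basis. (N \<inter> (\<lambda>y. norm (A y b)) -` {..<norm (A p b) + 1}))"
  have "open N'" unfolding N'_def
    by (intro open_Int open_INT finite_Basis ballI assms(3) continuous_open_preimage
        continuous_on_norm assms(2)) auto
  define K where "K = (\<Sum>b\<in>Basis. norm (A p b) + 1)"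
  have "norm (A y h) \<le> K * norm h" if "y \<in> N'" for y h
  proof -
    have "A y h = A y (\<Sum>b\<in>Basis. (h \<bullet> b) *\<^sub>R b)" by (simp add: euclidean_representation)
    also have "\<dots> = (\<Sum>b\<in>Basis. (h \<bullet> b) *\<^sub>R A y b)"
      using assms(1) that by (simp add: N'_def linear_sum linear_scale)
    also have "norm \<dots> \<le> (\<Sum>b\<in>Basis. norm h * (norm (A p b) + 1))"
      using that by (intro sum_norm_le) (force simp: N'_def Basis_le_norm intro!: mult_mono)
    finally show ?thesis by (simp add: K_def sum_distrib_left mult.commute)
  qed
  moreover have "p \<in> N'" using assms(4) by (simp add: N'_def)
  moreover have "K > 0" unfolding K_def by (intro sum_pos) (auto intro: add_nonneg_pos)
  ultimately show thesis using that[of K N'] \<open>open N'\<close> by (auto simp: N'_def)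
qed

text \<open>A tangent vector is the velocity of an arbitrary curve in \<open>M\<close>. Applying the
  derivative of an ambient smooth extension of the inverse chart to it produces \<open>h\<close>,
  and the local bound on this derivative gives \<open>K\<close>.\<close>

lemma chart_tangent_lift:
  assumes "(\<phi>, W) \<in> charts M" "q \<in> W"
  obtains K r where "K > 0" "r > 0" "ball q r \<subseteq> W"
    "\<And>x u. x \<in> ball q r \<Longrightarrow> u \<in> tangent_space M (\<phi> x) \<Longrightarrow>
      \<exists>h. u = frechet_derivative \<phi> (at x) h \<and> norm h \<le> K * norm u"
proof -
  have W: "open W" "openin (top_of_set M) (\<phi> ` W)" "inj_on \<phi> W" "smooth_on W \<phi>"
    "smooth_on (\<phi> ` W) (inv_into W \<phi>)"
    using assms by (auto simp: charts_def diffeo_def bij_betw_def)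
  obtain N0 \<psi> where N0: "open N0" "\<phi> q \<in> N0" "\<And>k. Ck_on k N0 \<psi>"
      "\<And>y. y \<in> \<phi> ` W \<inter> N0 \<Longrightarrow> \<psi> y = inv_into W \<phi> y"
    using smooth_onE[OF W(5)] imageI[OF assms(2)] by metis
  obtain N1 where N1: "open N1" "\<phi> ` W = M \<inter> N1" using W(2) by (auto simp: openin_open)
  define N where "N = N0 \<inter> N1"
  have d\<psi>: "(\<psi> has_derivative frechet_derivative \<psi> (at y)) (at y)" if "y \<in> N" for y
    using Ck_on_has_derivative[OF N0(3)] that by (simp add: N_def)
  have "continuous_on N (\<lambda>y. frechet_derivative \<psi> (at y) h)" for h
    using N0(3)[of 1] continuous_on_subset[of N0 _ N] by (auto simp: N_def)
  moreover have "open N" "\<phi> q \<in> N" using N0 N1 assms(2) by (auto simp: N_def)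
  ultimately obtain K N' where K: "K > 0" "open N'" "\<phi> q \<in> N'" "N' \<subseteq> N"
      "\<And>y h. y \<in> N' \<Longrightarrow> norm (frechet_derivative \<psi> (at y) h) \<le> K * norm h"
    using linear_locally_bounded[of N "\<lambda>y. frechet_derivative \<psi> (at y)" "\<phi> q"]
      has_derivative_linear[OF d\<psi>] by metis
  have "open (W \<inter> \<phi> -` N')"
    using continuous_open_preimage[OF smooth_on_continuous_on[OF W(4)] W(1) K(2)] .
  then obtain r where r: "r > 0" "ball q r \<subseteq> W \<inter> \<phi> -` N'"
    using assms(2) K(3) openE by (metis IntI vimageI)
  have "\<exists>h. u = frechet_derivative \<phi> (at x) h \<and> norm h \<le> K * norm u"
    if x: "x \<in> ball q r" and u: "u \<in> tangent_space M (\<phi> x)" for x u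
  proof -
    have x': "x \<in> W" "\<phi> x \<in> N'" "\<phi> x \<in> N" using r x K(4) by auto
    obtain \<gamma> e where \<gamma>: "e > 0" "\<And>t::real. \<bar>t\<bar> < e \<Longrightarrow> \<gamma> t \<in> M" "\<gamma> 0 = \<phi> x"
        "(\<gamma> has_vector_derivative u) (at 0)"
      using u unfolding tangent_space_def by blast
    define h where "h = frechet_derivative \<psi> (at (\<phi> x)) u"
    have "(\<gamma> has_derivative (\<lambda>t. t *\<^sub>R u)) (at 0)" using \<gamma>(4) by (simp add: has_vector_derivative_def)
    then have "((\<lambda>t. \<psi> (\<gamma> t)) has_derivative (\<lambda>t. frechet_derivative \<psi> (at (\<phi> x)) (t *\<^sub>R u))) (at 0)"
      by (rule has_derivative_compose) (use \<gamma>(3) d\<psi>[OF x'(3)] in auto)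
    then have c: "((\<lambda>t. \<psi> (\<gamma> t)) has_derivative (\<lambda>t. t *\<^sub>R h)) (at 0)"
      using has_derivative_linear[OF d\<psi>[OF x'(3)]] by (simp add: h_def linear_scale)
    have \<psi>\<phi>: "\<psi> (\<phi> x) = x" using N0(4)[of "\<phi> x"] x' inv_into_f_f[OF W(3)] by (auto simp: N_def)
    have "((\<lambda>t. \<phi> (\<psi> (\<gamma> t))) has_derivative (\<lambda>t. frechet_derivative \<phi> (at x) (t *\<^sub>R h))) (at 0)"
      by (rule has_derivative_compose[OF c]) (use \<gamma>(3) \<psi>\<phi> chart_has_derivative[OF assms(1) x'(1)] in auto)
    then have 1: "((\<lambda>t. \<phi> (\<psi> (\<gamma> t))) has_vector_derivative frechet_derivative \<phi> (at x) h) (at 0)"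
      by (simp add: has_vector_derivative_def linear_scale[OF chart_linear[OF assms(1) x'(1)]])
    have "isCont \<gamma> 0" using \<gamma>(4) has_vector_derivative_continuous by blast
    then have "\<forall>\<^sub>F t in at 0. \<gamma> t \<in> N"
      using topological_tendstoD[of \<gamma> "\<gamma> 0" "at 0" N] \<open>open N\<close> x' \<gamma>(3) by (auto simp: isCont_def)
    then obtain e' where e': "e' > 0" "\<And>t. t \<noteq> 0 \<Longrightarrow> \<bar>t\<bar> < e' \<Longrightarrow> \<gamma> t \<in> N"
      by (auto simp: eventually_at dist_real_def)
    \<comment> \<open>Near time 0 the curve runs in the part of \<open>M\<close> where \<phi> undoes
      \<psi>, so the curve pulled back and pushed forward is \<gamma> itself, and uniqueness of the
      derivative identifies its velocity with \<open>u\<close>.\<close>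
    have "\<phi> (\<psi> (\<gamma> t)) = \<gamma> t" if "t \<in> ball 0 (min e e')" for t
    proof -
      have "\<bar>t\<bar> < e" "\<bar>t\<bar> < e'" using that by auto
      then have "\<gamma> t \<in> M" "\<gamma> t \<in> N" using \<gamma>(2) e'(2)[of t] \<gamma>(3) x'(3) by metis+
      then show ?thesis using N0(4)[of "\<gamma> t"] N1(2) f_inv_into_f[of "\<gamma> t" \<phi> W] by (auto simp: N_def)
    qed
    then have "(\<gamma> has_vector_derivative frechet_derivative \<phi> (at x) h) (at 0)"
      by (intro has_vector_derivative_transform_within_open[OF 1 open_ball, of 0 "min e e'"])
        (use \<gamma>(1) e'(1) in auto)
    then have "u = frechet_derivative \<phi> (at x) h"
      using \<gamma>(4) vector_derivative_unique_at by blast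
    moreover have "norm h \<le> K * norm u" unfolding h_def by (rule K(5)[OF x'(2)])
    ultimately show ?thesis by (intro exI[of _ h] conjI)
  qed
  then show thesis using that[OF K(1) r(1)] r(2) by blast
qed

subsection \<open>Transverse curves\<close>

text \<open>In the applications \<open>w\<close> is the absolute value of the form and
  \<open>G\<close> the complement of \<open>Z\<close>. The velocity \<open>D\<close> is carried
  along as data because derivatives at the ends are one-sided. Tangency is defined by two-sided
  curves, so it is recorded separately for \<open>D b\<close>, the vector with which the next
  prolongation starts.\<close>

definition pos_curve ::
  "'a::euclidean_space set \<Rightarrow> 'a set \<Rightarrow> ('a \<Rightarrow> 'a \<Rightarrow> real) \<Rightarrow>
   real \<Rightarrow> (real \<Rightarrow> 'a) \<Rightarrow> (real \<Rightarrow> 'a) \<Rightarrow> bool" where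
  "pos_curve M G w b \<gamma> D \<longleftrightarrow>
     0 \<le> b \<and> continuous_on {0..b} D \<and>
     (\<forall>t\<in>{0..b}. (\<gamma> has_vector_derivative D t) (at t within {0..b}) \<and> \<gamma> t \<in> G \<and> 0 < w (\<gamma> t) (D t)) \<and>
     continuous_on {0..b} (\<lambda>t. w (\<gamma> t) (D t)) \<and> D b \<in> tangent_space M (\<gamma> b)"

section \<open>Concatenation of curves with matching velocities\<close>

lemma integral_shift_interval:
  fixes f :: "real \<Rightarrow> real"
  assumes "continuous_on {0..c} f" "0 \<le> c"
  shows "integral {b..b+c} (\<lambda>t. f (t - b)) = integral {0..c} f"
proof -
  have "(f has_integral integral {0..c} f) {0..c}"
    using assms by (simp add: integrable_continuous_real integrable_integral)
  then have "((\<lambda>t. f (1 *\<^sub>R t + (- b))) has_integral integral {0..c} f)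
      ((\<lambda>t. (1/1) *\<^sub>R t + - ((1/1) *\<^sub>R (- b))) ` cbox 0 c)"
    using has_integral_affinity[of f "integral {0..c} f" 0 c 1 "-b"] by (simp add: cbox_interval)
  moreover have "(\<lambda>t. (1/1) *\<^sub>R t + - ((1/1) *\<^sub>R (- b))) ` cbox 0 c = {b..b+c}"
    using assms(2) by (simp add: cbox_interval add.commute)
  ultimately show ?thesis by (simp add: integral_unique add.commute)
qed

lemma pos_curve_glue:
  assumes 1: "pos_curve M G w b \<gamma> D" and 2: "pos_curve M G w c \<eta> E"
    and eq: "\<eta> 0 = \<gamma> b" "E 0 = D b"
  defines "\<gamma>' \<equiv> \<lambda>t. if t \<le> b then \<gamma> t else \<eta> (t - b)"
    and "D' \<equiv> \<lambda>t. if t \<le> b then D t else E (t - b)"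
  shows "pos_curve M G w (b + c) \<gamma>' D'"
    "integral {0..b + c} (\<lambda>t. w (\<gamma>' t) (D' t)) =
      integral {0..b} (\<lambda>t. w (\<gamma> t) (D t)) + integral {0..c} (\<lambda>t. w (\<eta> t) (E t))"
proof -
  have bc: "0 \<le> b" "0 \<le> c" using 1 2 by (auto simp: pos_curve_def)
  have un: "{0..b + c} = {0..b} \<union> {b..b + c}" using bc by auto
  have shift: "(\<lambda>t. t - b) ` {b..b + c} \<subseteq> {0..c}" by auto
  have cD: "continuous_on {0..b + c} D'"
    unfolding D'_def un
  proof (rule continuous_on_cases)
    show "continuous_on {b..b + c} (\<lambda>t. E (t - b))"
      using 2 shift by (auto simp: pos_curve_def intro!: continuous_intros continuous_on_compose2[of "{0..c}" E])
  qed (use 1 eq in \<open>auto simp: pos_curve_def\<close>)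
  define F where "F t = (if t \<le> b then w (\<gamma> t) (D t) else w (\<eta> (t - b)) (E (t - b)))" for t
  have F: "w (\<gamma>' t) (D' t) = F t" for t by (simp add: F_def \<gamma>'_def D'_def)
  have cF: "continuous_on {0..b + c} F"
    unfolding F_def un
  proof (rule continuous_on_cases)
    have "continuous_on {0..c} (\<lambda>t. w (\<eta> t) (E t))" using 2 by (simp add: pos_curve_def)
    then show "continuous_on {b..b + c} (\<lambda>t. w (\<eta> (t - b)) (E (t - b)))"
      by (rule continuous_on_compose2[of _ _ _ "\<lambda>t. t - b"]) (use shift in \<open>auto intro!: continuous_intros\<close>)
  qed (use 1 eq in \<open>auto simp: pos_curve_def\<close>)
  have der: "(\<gamma>' has_vector_derivative D' t) (at t within {0..b + c})" if t: "t \<in> {0..b + c}" for t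
  proof -
    have "((\<lambda>t. if t \<in> {0..b} then \<gamma> t else \<eta> (t - b)) has_vector_derivative
        (if t \<in> {0..b} then D t else E (t - b))) (at t within {0..b + c})"
    proof (rule has_vector_derivative_If_within_closures)
      show "t \<in> {0..b} \<union> {b..b + c}" "{0..b + c} = {0..b} \<union> {b..b + c}" using t un by auto
      show "(\<gamma> has_vector_derivative D t) (at t within {0..b} \<union> (closure {0..b} \<inter> closure {b..b + c}))"
        if "t \<in> {0..b} \<union> (closure {0..b} \<inter> closure {b..b + c})"
      proof -
        have "{0..b} \<union> (closure {0..b} \<inter> closure {b..b + c}) = {0..b}" by auto
        then show ?thesis using that 1 by (simp add: pos_curve_def)
      qed
      show "((\<lambda>t. \<eta> (t - b)) has_vector_derivative E (t - b)) (at t within {b..b + c} \<union> (closure {0..b} \<inter> closure {b..b + c}))"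
        if "t \<in> {b..b + c} \<union> (closure {0..b} \<inter> closure {b..b + c})"
      proof -
        have set: "{b..b + c} \<union> (closure {0..b} \<inter> closure {b..b + c}) = {b..b + c}" using bc by auto
        have "(\<eta> has_vector_derivative E (t - b)) (at (t - b) within {0..c})"
          using that 2 bc unfolding set by (simp add: pos_curve_def)
        then have d1: "(\<eta> has_derivative (\<lambda>s. s *\<^sub>R E (t - b))) (at (t - b) within {0..c})"
          by (simp add: has_vector_derivative_def)
        have d2: "((\<lambda>t. t - b) has_derivative (\<lambda>s. s)) (at t within {b..b + c})"
          by (auto intro!: derivative_eq_intros)
        have "((\<lambda>t. \<eta> (t - b)) has_derivative (\<lambda>s. s *\<^sub>R E (t - b))) (at t within {b..b + c})"
          by (rule has_derivative_in_compose[OF d2 has_derivative_subset[OF d1 shift]])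
        then show ?thesis unfolding set by (simp add: has_vector_derivative_def)
      qed
    qed (use eq in auto)
    moreover have "(if t \<in> {0..b} then D t else E (t - b)) = D' t" using t by (simp add: D'_def)
    moreover have "\<gamma>' s = (if s \<in> {0..b} then \<gamma> s else \<eta> (s - b))" if "s \<in> {0..b + c}" for s
      using that by (simp add: \<gamma>'_def)
    ultimately show ?thesis
      by (intro has_vector_derivative_transform[OF t,
            of \<gamma>' "\<lambda>t. if t \<in> {0..b} then \<gamma> t else \<eta> (t - b)"]) simp_all
  qed
  \<comment> \<open>For \<open>c = 0\<close> the end of the glued curve is still the end of the
    first one.\<close>
  have "D' (b + c) \<in> tangent_space M (\<gamma>' (b + c))"
    using 1 2 bc eq unfolding D'_def \<gamma>'_def pos_curve_def by (cases "c = 0") auto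
  moreover have "\<gamma>' t \<in> G \<and> 0 < w (\<gamma>' t) (D' t)" if "t \<in> {0..b + c}" for t
    using that 1 2 by (auto simp: \<gamma>'_def D'_def pos_curve_def)
  ultimately show "pos_curve M G w (b + c) \<gamma>' D'"
    unfolding pos_curve_def F using cD cF der bc by (auto simp flip: F)
  have "integral {0..b + c} F = integral {0..b} F + integral {b..b + c} F"
    using bc cF by (intro Henstock_Kurzweil_Integration.integral_combine[symmetric] integrable_continuous_real) auto
  also have "integral {0..b} F = integral {0..b} (\<lambda>t. w (\<gamma> t) (D t))"
    by (intro Henstock_Kurzweil_Integration.integral_cong) (auto simp: F_def)
  also have "integral {b..b + c} F = integral {b..b + c} (\<lambda>t. w (\<eta> (t - b)) (E (t - b)))"
    by (intro Henstock_Kurzweil_Integration.integral_cong) (use eq in \<open>auto simp: F_def\<close>)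
  also have "\<dots> = integral {0..c} (\<lambda>t. w (\<eta> t) (E t))"
    using integral_shift_interval[of c "\<lambda>t. w (\<eta> t) (E t)"] 2 by (simp add: pos_curve_def)
  finally show "integral {0..b + c} (\<lambda>t. w (\<gamma>' t) (D' t)) =
      integral {0..b} (\<lambda>t. w (\<gamma> t) (D t)) + integral {0..c} (\<lambda>t. w (\<eta> t) (E t))" by (simp add: F)
qed

text \<open>Squaring removes the corner of \<open>max 0 y\<close> at 0. This yields an explicit
  primitive of the piecewise linear cut-off by which velocities are turned.\<close>

lemma max_square_has_derivative:
  "((\<lambda>y::real. (max 0 y)\<^sup>2) has_real_derivative 2 * max 0 y) (at y)"
proof (cases "y = 0")
  case True
  have "((\<lambda>h::real. (max 0 h)\<^sup>2 / h) \<longlongrightarrow> 0) (at 0)"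
    by (rule Lim_null_comparison[of _ "\<lambda>h. \<bar>h\<bar>"])
      (auto intro!: always_eventually tendsto_eq_intros simp: max_def power2_eq_square)
  then show ?thesis using True by (simp add: DERIV_def)
next
  case False
  consider "y > 0" | "y < 0" using False by linarith
  then show ?thesis
  proof cases
    case 1
    have "((\<lambda>y::real. y\<^sup>2) has_real_derivative 2 * y) (at y)"
      by (auto intro!: derivative_eq_intros)
    then have "((\<lambda>y::real. (max 0 y)\<^sup>2) has_real_derivative 2 * y) (at y)"
      by (rule DERIV_cong_ev[THEN iffD1, rotated -1])
        (use 1 in \<open>auto simp: eventually_nhds intro!: exI[of _ "{0<..}"]\<close>)
    then show ?thesis using 1 by simp
  next
    case 2
    have "((\<lambda>y::real. 0) has_real_derivative 0) (at y)" by simp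
    then have "((\<lambda>y::real. (max 0 y)\<^sup>2) has_real_derivative 0) (at y)"
      by (rule DERIV_cong_ev[THEN iffD1, rotated -1])
        (use 2 in \<open>auto simp: eventually_nhds intro!: exI[of _ "{..<0}"]\<close>)
    then show ?thesis using 2 by simp
  qed
qed

lemma continuous_on_linear_apply:
  fixes A :: "'s::topological_space \<Rightarrow> 'b::euclidean_space \<Rightarrow> 'c::real_normed_vector"
  assumes "\<And>s. s \<in> S \<Longrightarrow> linear (A s)" "\<And>h. continuous_on S (\<lambda>s. A s h)" "continuous_on S y"
  shows "continuous_on S (\<lambda>s. A s (y s))"
proof -
  have "A s (y s) = (\<Sum>b\<in>Basis. (y s \<bullet> b) *\<^sub>R A s b)" if "s \<in> S" for s
  proof -
    have "A s (y s) = A s (\<Sum>b\<in>Basis. (y s \<bullet> b) *\<^sub>R b)" by (simp add: euclidean_representation)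
    also have "\<dots> = (\<Sum>b\<in>Basis. (y s \<bullet> b) *\<^sub>R A s b)"
      using assms(1)[OF that] by (simp add: linear_sum linear_scale)
    finally show ?thesis .
  qed
  then show ?thesis by (auto intro!: continuous_intros assms(2,3) cong: continuous_on_cong)
qed

text \<open>The velocity of the curve starts at \<open>u0\<close> and is turned linearly to \<open>e\<close> within a short
  time; both velocities are positive on \<open>A\<close>, hence so are their convex combinations.\<close>

lemma turning_segment:
  fixes \<Phi> :: "'e::euclidean_space \<Rightarrow> 'a::euclidean_space"
  assumes B: "open B" "\<And>x. x \<in> B \<Longrightarrow> (\<Phi> has_derivative \<Phi>' x) (at x)"
      "\<And>h. continuous_on B (\<lambda>x. \<Phi>' x h)" "continuous_on B A" "\<And>x. x \<in> B \<Longrightarrow> \<Phi> x \<in> G"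
    and w: "\<And>x h. x \<in> B \<Longrightarrow> w (\<Phi> x) (\<Phi>' x h) = \<bar>A x \<bullet> h\<bar>"
    and tan: "\<And>x h. x \<in> B \<Longrightarrow> \<Phi>' x h \<in> tangent_space M (\<Phi> x)"
    and e: "\<And>x. x \<in> B \<Longrightarrow> c \<le> A x \<bullet> e" "c > 0" "T > 0"
      "\<And>t. 0 \<le> t \<Longrightarrow> t \<le> T \<Longrightarrow> x0 + t *\<^sub>R e \<in> B"
    and u0: "A x0 \<bullet> u0 > 0"
  obtains \<eta> E where "pos_curve M G w T \<eta> E" "\<eta> 0 = \<Phi> x0" "E 0 = \<Phi>' x0 u0"
    "c * T / 2 \<le> integral {0..T} (\<lambda>t. w (\<eta> t) (E t))"
proof -
  have x0: "x0 \<in> B" using e(4)[of 0] e(3) by simp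
  \<comment> \<open>Compactness of the straight segment provides a margin \<rho> by which the actual
    curve may deviate from it without leaving \<open>B\<close>.\<close>
  have seg: "compact ((\<lambda>t. x0 + t *\<^sub>R e) ` {0..T})"
    by (intro compact_continuous_image continuous_intros) auto
  then obtain \<rho> where \<rho>: "\<rho> > 0" "(\<Union>x\<in>(\<lambda>t. x0 + t *\<^sub>R e) ` {0..T}. ball x \<rho>) \<subseteq> B"
    using e(4) by (elim compact_subset_open_imp_ball_epsilon_subset[OF _ B(1)]) auto
  have "open {x \<in> B. 0 < A x \<bullet> u0}"
    using continuous_open_preimage[OF continuous_on_inner[OF B(4) continuous_on_const] B(1), of "{0<..}"]
    by (simp add: vimage_def Int_def)
  then obtain \<rho>2 where \<rho>2: "\<rho>2 > 0" "ball x0 \<rho>2 \<subseteq> {x \<in> B. 0 < A x \<bullet> u0}"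
    using x0 u0 openE[of "{x \<in> B. 0 < A x \<bullet> u0}" x0] by auto
  define K where "K = norm e + norm (u0 - e) + 1"
  have K: "K > 0" by (simp add: K_def add_nonneg_pos)
  \<comment> \<open>The turning time: \<open>T/2\<close> leaves at least half of the time for the
    straight motion, \<open>\<rho> / K\<close> keeps the deviation within the margin, and
    \<open>\<rho>2 / K\<close> keeps the curve, while it turns, where \<open>u0\<close> is still
    positive. Only this time depends on \<open>u0\<close>.\<close>
  define \<epsilon> where "\<epsilon> = min (T/2) (min (\<rho> / K) (\<rho>2 / K))"
  have \<epsilon>: "\<epsilon> > 0" "\<epsilon> \<le> T/2" "\<epsilon> * K \<le> \<rho>" "\<epsilon> * K \<le> \<rho>2"
    using e(3) \<rho> \<rho>2 K by (auto simp: \<epsilon>_def min_def field_simps)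
  \<comment> \<open>The weight of \<open>u0\<close> in the velocity falls from 1 to 0 during the
    turning time; \<open>\<kappa>\<close> is its primitive vanishing at 0, so \<open>x'\<close> is
    the derivative of \<open>x\<close>.\<close>
  define \<theta> where "\<theta> t = max 0 (1 - t / \<epsilon>)" for t
  define \<kappa> where "\<kappa> t = \<epsilon> / 2 * (1 - (\<theta> t)\<^sup>2)" for t
  define x where "x t = x0 + t *\<^sub>R e + \<kappa> t *\<^sub>R (u0 - e)" for t
  define x' where "x' t = e + \<theta> t *\<^sub>R (u0 - e)" for t
  have \<theta>01: "0 \<le> \<theta> t" "\<theta> t \<le> 1" if "0 \<le> t" for t using that \<epsilon>(1) by (auto simp: \<theta>_def)
  have \<kappa>01: "0 \<le> \<kappa> t" "\<kappa> t \<le> \<epsilon> / 2" if "0 \<le> t" for t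
    using \<theta>01[OF that] \<epsilon>(1) by (auto simp: \<kappa>_def power_le_one intro!: mult_left_le)
  have d\<kappa>: "(\<kappa> has_real_derivative \<theta> t) (at t)" for t
  proof -
    have "((\<lambda>t. (max 0 (1 - t / \<epsilon>))\<^sup>2) has_real_derivative 2 * max 0 (1 - t / \<epsilon>) * (- (1 / \<epsilon>))) (at t)"
      by (rule DERIV_chain2[OF max_square_has_derivative])
        (use \<epsilon>(1) in \<open>auto intro!: derivative_eq_intros\<close>)
    then have "((\<lambda>t. \<epsilon> / 2 * (1 - (max 0 (1 - t / \<epsilon>))\<^sup>2)) has_real_derivative
        \<epsilon> / 2 * (0 - 2 * max 0 (1 - t / \<epsilon>) * (- (1 / \<epsilon>)))) (at t)"
      by (intro DERIV_cmult DERIV_diff DERIV_const)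
    then show ?thesis using \<epsilon>(1) unfolding \<kappa>_def \<theta>_def by simp
  qed
  have dx: "(x has_vector_derivative x' t) (at t)" for t
  proof -
    have "((\<lambda>t. x0 + t *\<^sub>R e + \<kappa> t *\<^sub>R (u0 - e)) has_vector_derivative
        0 + (t *\<^sub>R 0 + 1 *\<^sub>R e) + (\<kappa> t *\<^sub>R 0 + \<theta> t *\<^sub>R (u0 - e))) (at t)"
      by (intro has_vector_derivative_add has_vector_derivative_const has_vector_derivative_scaleR
          d\<kappa> DERIV_ident)
    then show ?thesis by (simp add: x_def[abs_def] x'_def)
  qed
  have xB: "x t \<in> B" if "t \<in> {0..T}" for t
  proof -
    have "norm (\<kappa> t *\<^sub>R (u0 - e)) \<le> \<epsilon> / 2 * norm (u0 - e)"
      unfolding norm_scaleR using \<kappa>01[of t] that by (intro mult_right_mono) auto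
    also have "\<dots> \<le> \<epsilon> / 2 * K" using \<epsilon>(1) by (simp add: K_def)
    also have "\<dots> < \<rho>" using \<epsilon>(1,3) K \<rho>(1) by (simp add: field_simps)
    finally have "x t \<in> ball (x0 + t *\<^sub>R e) \<rho>" by (simp add: x_def dist_norm)
    moreover have "x0 + t *\<^sub>R e \<in> (\<lambda>t. x0 + t *\<^sub>R e) ` {0..T}" using that by (rule imageI)
    ultimately show ?thesis by (intro subsetD[OF \<rho>(2)] UN_I)
  qed
  have Ax': "A (x t) \<bullet> x' t = (1 - \<theta> t) * (A (x t) \<bullet> e) + \<theta> t * (A (x t) \<bullet> u0)" for t
    by (simp add: x'_def inner_add_right inner_diff_right algebra_simps)
  have late: "c \<le> A (x t) \<bullet> x' t" if "t \<in> {\<epsilon>..T}" for t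
    using that e(1)[OF xB[of t]] \<epsilon>(1) by (simp add: Ax' \<theta>_def)
  have pos: "0 < A (x t) \<bullet> x' t" if "t \<in> {0..T}" for t
  proof (cases "t < \<epsilon>")
    case True
    have "norm (t *\<^sub>R e + \<kappa> t *\<^sub>R (u0 - e)) \<le> \<epsilon> * norm e + \<epsilon> * norm (u0 - e)"
      by (rule order.trans[OF norm_triangle_ineq], rule add_mono)
        (use that True \<kappa>01[of t] in \<open>auto intro!: mult_right_mono\<close>)
    also have "\<dots> < \<epsilon> * K" using \<epsilon>(1) by (simp add: K_def algebra_simps)
    finally have "dist (x t) x0 < \<rho>2" using \<epsilon>(4) by (simp add: x_def dist_norm)
    then have "x t \<in> ball x0 \<rho>2" by (simp add: dist_commute)
    then have "0 < A (x t) \<bullet> u0" using \<rho>2(2) by auto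
    moreover have "0 < A (x t) \<bullet> e" using e(1)[OF xB[OF that]] e(2) by simp
    ultimately show ?thesis unfolding Ax' using \<theta>01[of t] that
      by (cases "\<theta> t = 0") (auto intro!: add_nonneg_pos mult_nonneg_nonneg)
  next
    case False
    then show ?thesis using late[of t] e(2) that by auto
  qed
  define \<eta> where "\<eta> t = \<Phi> (x t)" for t
  define E where "E t = \<Phi>' (x t) (x' t)" for t
  have cx: "continuous_on {0..T} x"
    using dx by (meson continuous_at_imp_continuous_on has_vector_derivative_continuous)
  have cx': "continuous_on {0..T} x'" unfolding x'_def \<theta>_def by (intro continuous_intros) (use \<epsilon> in auto)
  have xim: "x ` {0..T} \<subseteq> B" using xB by auto
  have lin: "linear (\<Phi>' y)" if "y \<in> B" for y using B(2)[OF that] has_derivative_linear by blast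
  have wE: "w (\<eta> t) (E t) = A (x t) \<bullet> x' t" if "t \<in> {0..T}" for t
    using w[OF xB[OF that]] pos[OF that] by (simp add: \<eta>_def E_def)
  have cAx: "continuous_on {0..T} (\<lambda>t. A (x t) \<bullet> x' t)"
    by (intro continuous_on_inner cx' continuous_on_compose2[OF B(4) cx xim])
  have "continuous_on {0..T} E" unfolding E_def
    by (rule continuous_on_linear_apply) (use lin xB in \<open>auto intro: cx' continuous_on_compose2[OF B(3) cx xim]\<close>)
  moreover have "(\<eta> has_vector_derivative E t) (at t within {0..T})" if "t \<in> {0..T}" for t
  proof -
    have "(\<Phi> \<circ> x has_vector_derivative E t) (at t)"
      using vector_derivative_diff_chain_within[OF has_vector_derivative_at_within[OF dx] has_derivative_at_withinI[OF B(2)[OF xB[OF that]]]]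
      by (simp add: E_def)
    then show ?thesis by (simp add: \<eta>_def[abs_def] o_def has_vector_derivative_at_within)
  qed
  moreover have "continuous_on {0..T} (\<lambda>t. w (\<eta> t) (E t))" 
    by (rule continuous_on_eq[OF cAx]) (simp add: wE)
  ultimately have "pos_curve M G w T \<eta> E"
    using e(3) pos wE B(5) xB tan by (auto simp: pos_curve_def \<eta>_def E_def)
  moreover have "x 0 = x0" "x' 0 = u0" using \<epsilon>(1) by (simp_all add: x_def x'_def \<kappa>_def \<theta>_def)
  then have "\<eta> 0 = \<Phi> x0" "E 0 = \<Phi>' x0 u0" by (simp_all add: \<eta>_def E_def)
  moreover have "c * T / 2 \<le> integral {0..T} (\<lambda>t. w (\<eta> t) (E t))"
  proof -
    have int: "(\<lambda>t. A (x t) \<bullet> x' t) integrable_on {a..b}" if "0 \<le> a" "b \<le> T" for a b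
      using that by (intro integrable_continuous_real continuous_on_subset[OF cAx]) auto
    \<comment> \<open>The contribution of the turn is positive but may be arbitrarily small, so it
      is dropped; the rest lasts at least \<open>T/2\<close>.\<close>
    have "c * T / 2 \<le> c * (T - \<epsilon>)" using \<epsilon>(2) e(2) by (simp add: field_simps)
    also have "\<dots> = integral {\<epsilon>..T} (\<lambda>t. c)" using \<epsilon> e(3) by simp
    also have "\<dots> \<le> integral {\<epsilon>..T} (\<lambda>t. A (x t) \<bullet> x' t)"
      using late \<epsilon> by (intro integral_le int) auto
    also have "\<dots> \<le> integral {0..\<epsilon>} (\<lambda>t. A (x t) \<bullet> x' t) + integral {\<epsilon>..T} (\<lambda>t. A (x t) \<bullet> x' t)"
      using pos \<epsilon> e(3) by (simp, intro Henstock_Kurzweil_Integration.integral_nonneg int) (auto intro: less_imp_le)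
    also have "\<dots> = integral {0..T} (\<lambda>t. A (x t) \<bullet> x' t)"
      using \<epsilon> e(3) by (intro Henstock_Kurzweil_Integration.integral_combine int) auto
    also have "\<dots> = integral {0..T} (\<lambda>t. w (\<eta> t) (E t))"
      by (intro Henstock_Kurzweil_Integration.integral_cong) (simp add: wE)
    finally show ?thesis .
  qed
  ultimately show thesis using that by blast
qed

subsection \<open>Prolongation near regular points\<close>

text \<open>The duration \<open>T\<close> may depend on \<open>u\<close>, the constant \<delta> may
  not. The first bound estimates lengths from above, the second is the gain of a prolongation with
  prescribed initial velocity; with both under one constant a single compactness argument makes both
  uniform.\<close>

definition locally_good ::
  "'a::euclidean_space set \<Rightarrow> 'a set \<Rightarrow> ('a \<Rightarrow> 'a \<Rightarrow> real) \<Rightarrow> real \<Rightarrow> 'a \<Rightarrow> bool" where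
  "locally_good M G w \<delta> y \<longleftrightarrow>
     (\<forall>u\<in>tangent_space M y. \<delta> * w y u \<le> norm u \<and>
        (y \<in> G \<and> 0 < w y u \<longrightarrow>
          (\<exists>T \<eta> E. pos_curve M G w T \<eta> E \<and> \<eta> 0 = y \<and> E 0 = u \<and>
             \<delta> \<le> integral {0..T} (\<lambda>t. w (\<eta> t) (E t)))))"

section \<open>The form in coordinates near a regular point\<close>

lemma abs_val_eqI:
  assumes "zero_ext Z V p \<noteq> {}" "\<And>\<alpha>. \<alpha> \<in> zero_ext Z V p \<Longrightarrow> \<bar>\<alpha> u\<bar> = c"
  shows "abs_val Z V p u = c"
  unfolding abs_val_def using assms by (intro the_equality) auto

lemma chart_image_nhd:
  assumes "(\<phi>, W) \<in> charts M" "open B" "B \<subseteq> W" "x \<in> B"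
  obtains N where "open N" "\<phi> x \<in> N" "N \<inter> M = \<phi> ` B"
proof -
  have "openin (top_of_set M) (\<phi> ` B)"
    using chart_open_subset[OF assms(1-3)] by (auto simp: charts_def)
  then obtain N where "open N" "\<phi> ` B = M \<inter> N" by (auto simp: openin_open)
  then show thesis using that[of N] assms(4) by auto
qed

lemma linear_inner_axis:
  fixes f :: "real^'n \<Rightarrow> real"
  assumes "linear f"
  shows "f h = (\<chi> i. f (axis i 1)) \<bullet> h"
proof -
  have "f h = f (\<Sum>i\<in>UNIV. (h $ i) *\<^sub>R axis i 1)"
    by (simp add: basis_expansion flip: scalar_mult_eq_scaleR)
  also have "\<dots> = (\<Sum>i\<in>UNIV. h $ i * f (axis i 1))"
    using assms by (simp add: linear_sum linear_scale)
  finally show ?thesis by (simp add: inner_vec_def mult.commute)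
qed

text \<open>This supplies the covector field \<open>A\<close> of
  \<open>turning_segment\<close>.\<close>

lemma section_coeff:
  assumes "(\<phi>, W) \<in> charts U" "section_on U V v" "x \<in> W"
  shows "v (\<phi> x) (frechet_derivative \<phi> (at x) h) = (\<chi> i. coeff \<phi> v i x) \<bullet> h"
proof -
  have "\<phi> x \<in> U" using chart_subset[OF assms(1)] assms(3) by auto
  then have lin: "v (\<phi> x) (a *\<^sub>R u + b *\<^sub>R y) = a * v (\<phi> x) u + b * v (\<phi> x) y"
    if "u \<in> tangent_space U (\<phi> x)" "y \<in> tangent_space U (\<phi> x)" for u y a b
    using assms(2) that by (auto simp: section_on_def smooth_1form_def cotangent_space_def)
  note T = chart_derivative_tangent[OF assms(1,3)]
  note L = chart_linear[OF assms(1,3)]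
  have "linear (\<lambda>h. v (\<phi> x) (frechet_derivative \<phi> (at x) h))"
  proof (rule linearI)
    show "v (\<phi> x) (frechet_derivative \<phi> (at x) (h + k)) =
        v (\<phi> x) (frechet_derivative \<phi> (at x) h) + v (\<phi> x) (frechet_derivative \<phi> (at x) k)" for h k
      using lin[OF T T, of 1 h 1 k] by (simp add: linear_add[OF L])
    show "v (\<phi> x) (frechet_derivative \<phi> (at x) (c *\<^sub>R h)) = c *\<^sub>R v (\<phi> x) (frechet_derivative \<phi> (at x) h)" for c h
      using lin[OF T T, of c h 0 h] by (simp add: linear_scale[OF L])
  qed
  then show ?thesis by (subst linear_inner_axis) (simp_all add: coeff_def partial_def)
qed

text \<open>The coefficient vector is continuous and nonzero at \<open>x1\<close>, so on a small
  ball its inner product with its value at \<open>x1\<close> is bounded below. Up to sign, that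
  value is the direction towards which velocities are turned.\<close>

lemma locally_good_regular:
  assumes M: "(\<phi>, W) \<in> charts M" and U: "(\<phi>, W) \<in> charts U" and x1: "x1 \<in> W"
    and UZ: "U \<subseteq> M - Z" and V: "section_on U V v" and nz: "v (\<phi> x1) \<noteq> (\<lambda>u. 0)"
  obtains N \<delta> where "open N" "\<phi> x1 \<in> N" "\<delta> > 0"
    "\<And>y. y \<in> N \<inter> M \<Longrightarrow> locally_good M (M - Z) (abs_val Z V) \<delta> y"
proof -
  define A where "A x = (\<chi> i. coeff \<phi> v i x)" for x
  have cA: "continuous_on W A"
    unfolding A_def using V U
    by (intro continuous_on_vec_lambda smooth_on_continuous_on) (auto simp: section_on_def smooth_1form_def)
  have inU: "\<phi> x \<in> U" if "x \<in> W" for x using chart_subset[OF U] that by auto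
  have wA: "abs_val Z V (\<phi> x) (frechet_derivative \<phi> (at x) h) = \<bar>A x \<bullet> h\<bar>" if "x \<in> W" for x h
  proof -
    have "zero_ext Z V (\<phi> x) = {v (\<phi> x), (\<lambda>u. - v (\<phi> x) u)}"
      using V inU[OF that] UZ by (auto simp: zero_ext_def section_on_def)
    then show ?thesis
      using section_coeff[OF U V that, of h] by (intro abs_val_eqI) (auto simp: A_def)
  qed
  \<comment> \<open>Covectors are 0 off the tangent space by convention, so a vector with nonzero
    value is tangent and comes from the chart. Hence the coefficient vector at \<open>x1\<close>
    does not vanish.\<close>
  obtain u where u: "v (\<phi> x1) u \<noteq> 0" using nz by auto
  then have "u \<in> tangent_space U (\<phi> x1)"
    using V inU[OF x1] by (auto simp: section_on_def smooth_1form_def cotangent_space_def)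
  then obtain h where "u = frechet_derivative \<phi> (at x1) h"
    using chart_tangent_lift[OF U x1] by (metis centre_in_ball)
  then have "A x1 \<noteq> 0" using u section_coeff[OF U V x1, of h] by (auto simp: A_def)
  define a where "a = norm (A x1)"
  have a: "a > 0" using \<open>A x1 \<noteq> 0\<close> by (simp add: a_def)
  obtain K r0 where K: "K > 0" "r0 > 0" "ball x1 r0 \<subseteq> W"
    "\<And>x u. x \<in> ball x1 r0 \<Longrightarrow> u \<in> tangent_space M (\<phi> x) \<Longrightarrow>
      \<exists>h. u = frechet_derivative \<phi> (at x) h \<and> norm h \<le> K * norm u"
    using chart_tangent_lift[OF M x1] by metis
  have "isCont A x1" using cA x1 K(3) continuous_on_eq_continuous_at[of "ball x1 r0"] K(2)
    by (meson centre_in_ball continuous_on_subset open_ball)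
  then obtain r1 where r1: "r1 > 0" "\<And>x. dist x x1 < r1 \<Longrightarrow> dist (A x) (A x1) < min 1 (a / 2)"
    using a unfolding continuous_at_eps_delta by (metis half_gt_zero min_less_iff_conj zero_less_one)
  define r where "r = min r0 r1"
  have r: "r > 0" "ball x1 r \<subseteq> ball x1 r0" "ball x1 r \<subseteq> W" using K r1 by (auto simp: r_def)
  have close: "norm (A x - A x1) < 1" "norm (A x - A x1) < a / 2" if "x \<in> ball x1 r" for x
  proof -
    have "dist x x1 < r1" using that by (simp add: r_def dist_commute)
    then show "norm (A x - A x1) < 1" "norm (A x - A x1) < a / 2"
      using r1(2)[of x] by (simp_all add: dist_norm)
  qed
  have upper: "norm (A x) \<le> a + 1" if "x \<in> ball x1 r" for x
    using close(1)[OF that] norm_triangle_sub[of "A x" "A x1"] by (simp add: a_def)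
  have lower: "a\<^sup>2 / 2 \<le> A x \<bullet> A x1" if "x \<in> ball x1 r" for x
  proof -
    have "\<bar>(A x - A x1) \<bullet> A x1\<bar> \<le> a / 2 * a"
      using Cauchy_Schwarz_ineq2[of "A x - A x1" "A x1"] close(2)[OF that] a
      by (smt (verit, best) a_def mult_right_mono)
    moreover have "A x \<bullet> A x1 = (A x - A x1) \<bullet> A x1 + a\<^sup>2"
      by (simp add: inner_diff_left a_def dot_square_norm)
    ultimately show ?thesis by (simp add: power2_eq_square)
  qed
  obtain N where N: "open N" "\<phi> x1 \<in> N" "N \<inter> M = \<phi> ` ball x1 (r/2)"
    using chart_image_nhd[OF M open_ball, of x1 "r/2" x1] r by (auto simp: subset_iff)
  \<comment> \<open>Speed \<open>a\<close> for the time \<open>T\<close> covers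
    \<open>r / 4\<close>, so a segment starting in the ball of radius \<open>r/2\<close> stays in
    the ball of radius \<open>r\<close>. The entries of \<delta> come from the upper bound
    \<open>a + 1\<close> on the coefficients with the lifting constant \<open>K\<close>, and from
    the gain \<open>c * T / 2\<close> with \<open>c\<close> equal to half the square of
    \<open>a\<close>.\<close>
  define T where "T = r / (4 * a)"
  define \<delta> where "\<delta> = min (1 / ((a + 1) * K)) (a\<^sup>2 / 2 * T / 2)"
  have T: "T > 0" using r a by (simp add: T_def)
  have \<delta>: "\<delta> > 0" using a K T by (simp add: \<delta>_def)
  have "locally_good M (M - Z) (abs_val Z V) \<delta> y" if y: "y \<in> N \<inter> M" for y
    unfolding locally_good_def
  proof (intro ballI conjI impI)
    obtain x where x: "x \<in> ball x1 (r/2)" "y = \<phi> x" using y N(3) by auto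
    then have xr: "x \<in> ball x1 r" and xW: "x \<in> W" using r by auto
    fix u assume u: "u \<in> tangent_space M y"
    then obtain h where h: "u = frechet_derivative \<phi> (at x) h" "norm h \<le> K * norm u"
      using K(4)[of x u] subsetD[OF r(2) xr] x(2) by auto
    have w: "abs_val Z V y u = \<bar>A x \<bullet> h\<bar>" using wA[OF xW] h x by simp
    also have "\<dots> \<le> norm (A x) * norm h" by (rule Cauchy_Schwarz_ineq2)
    also have "\<dots> \<le> (a + 1) * (K * norm u)"
      using upper[OF xr] h(2) a by (intro mult_mono) auto
    finally have "\<delta> * abs_val Z V y u \<le> 1 / ((a + 1) * K) * ((a + 1) * (K * norm u))"
      using w a K \<delta> by (intro mult_mono) (auto simp: \<delta>_def)
    then show "\<delta> * abs_val Z V y u \<le> norm u" using a K by simp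
    assume "y \<in> M - Z \<and> 0 < abs_val Z V y u"
    then have "A x \<bullet> h \<noteq> 0" using w by auto
    \<comment> \<open>The local sign of the form for which the given velocity is positive.\<close>
    define s where "s = sgn (A x \<bullet> h)"
    have s: "s * s = 1" "\<bar>s\<bar> = 1" using \<open>A x \<bullet> h \<noteq> 0\<close> by (auto simp: s_def sgn_if)
    obtain \<eta> E where "pos_curve M (M - Z) (abs_val Z V) T \<eta> E" "\<eta> 0 = \<phi> x"
        "E 0 = frechet_derivative \<phi> (at x) h"
        "a\<^sup>2 / 2 * T / 2 \<le> integral {0..T} (\<lambda>t. abs_val Z V (\<eta> t) (E t))"
    proof (rule turning_segment[of "ball x1 r" \<phi> "\<lambda>x. frechet_derivative \<phi> (at x)" "\<lambda>x. s *\<^sub>R A x" "M - Z"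
          "abs_val Z V" M "a\<^sup>2 / 2" "s *\<^sub>R A x1" T x h])
      show "continuous_on (ball x1 r) (\<lambda>x. frechet_derivative \<phi> (at x) h)" for h
        using M r(3) by (auto simp: charts_def diffeo_def
            intro: continuous_on_subset[OF smooth_on_continuous_derivative])
      show "continuous_on (ball x1 r) (\<lambda>x. s *\<^sub>R A x)"
        by (intro continuous_intros continuous_on_subset[OF cA r(3)])
      show "abs_val Z V (\<phi> x) (frechet_derivative \<phi> (at x) h) = \<bar>s *\<^sub>R A x \<bullet> h\<bar>" if "x \<in> ball x1 r" for x h
        using wA[of x h] r that by (auto simp: abs_mult s)
      show "a\<^sup>2 / 2 \<le> s *\<^sub>R A x \<bullet> s *\<^sub>R A x1" if "x \<in> ball x1 r" for x
        using lower[OF that] s by (simp add: mult.assoc[symmetric])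
      show "x + t *\<^sub>R s *\<^sub>R A x1 \<in> ball x1 r" if "0 \<le> t" "t \<le> T" for t
      proof -
        have "norm (t *\<^sub>R s *\<^sub>R A x1) \<le> T * a" using that s a by (simp add: a_def mult_right_mono abs_mult)
        also have "\<dots> < r / 2" using a r by (simp add: T_def)
        finally have "dist x (x + t *\<^sub>R s *\<^sub>R A x1) < r / 2" by (simp add: dist_norm)
        then show ?thesis using x(1) dist_triangle[of x1 "x + t *\<^sub>R s *\<^sub>R A x1" x]
          unfolding mem_ball by linarith
      qed
      show "\<phi> x \<in> M - Z" if "x \<in> ball x1 r" for x using inU subsetD[OF r(3) that] UZ by blast
      show "0 < s *\<^sub>R A x \<bullet> h" using \<open>A x \<bullet> h \<noteq> 0\<close> by (simp add: s_def sgn_if)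
    qed (use r a T chart_has_derivative[OF M] chart_derivative_tangent[OF M] in auto)
    then show "\<exists>T \<eta> E. pos_curve M (M - Z) (abs_val Z V) T \<eta> E \<and> \<eta> 0 = y \<and> E 0 = u \<and>
        \<delta> \<le> integral {0..T} (\<lambda>t. abs_val Z V (\<eta> t) (E t))"
      using x(2) h(1) by (intro exI[of _ T] exI[of _ \<eta>] exI[of _ E]) (auto simp: \<delta>_def)
  qed
  then show thesis using that[OF N(1,2) \<delta>] by blast
qed

subsection \<open>Prolongation near cylindrical points\<close>

text \<open>Differentiating \<open>s^2 = w^k\<close> gives \<open>s' = k / 2 * (s / z)\<close>. The
  two roots differ by a sign, which the absolute value removes, so any root \<open>u\<close> may
  replace the branch.\<close>

lemma Re_d_sqrt_pow_cases:
  fixes x h :: "real^3"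
  defines "z \<equiv> Complex (x $ 1) (x $ 2)"
  assumes z: "z \<noteq> 0" and u: "u\<^sup>2 = z ^ k" and \<beta>: "\<beta> \<in> Re_d_sqrt_pow k x"
  shows "\<bar>\<beta> h\<bar> = \<bar>Re (of_nat k / 2 * (u / z) * Complex (h $ 1) (h $ 2))\<bar>"
proof -
  obtain s N where s: "open N" "z \<in> N" "s holomorphic_on N" "\<And>w. w \<in> N \<Longrightarrow> s w ^ 2 = w ^ k"
      and \<beta>_eq: "\<beta> = (\<lambda>h. Re (deriv s z * Complex (h $ 1) (h $ 2)))"
    using \<beta> z unfolding Re_d_sqrt_pow_def z_def[symmetric] by (auto simp: Let_def)
  have "(s has_field_derivative deriv s z) (at z)"
    using holomorphic_derivI[OF s(3,1,2)] .
  then have "((\<lambda>w. s w ^ 2) has_field_derivative 2 * s z * deriv s z) (at z)"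
    by (auto intro!: derivative_eq_intros)
  then have "((\<lambda>w. w ^ k) has_field_derivative 2 * s z * deriv s z) (at z)"
    by (rule has_field_derivative_transform_within_open[OF _ s(1,2)]) (use s(4) in auto)
  moreover have "((\<lambda>w. w ^ k) has_field_derivative of_nat k * z ^ (k - 1)) (at z)"
    by (auto intro!: derivative_eq_intros)
  ultimately have d: "2 * s z * deriv s z = of_nat k * z ^ (k - 1)" by (rule DERIV_unique)
  have sz: "s z ^ 2 = z ^ k" using s by auto
  then have "s z \<noteq> 0" using z by auto
  have "2 * s z * (z * deriv s z) = of_nat k * z ^ k"
    using d by (cases k) (auto simp: algebra_simps)
  also have "\<dots> = 2 * s z * (of_nat k / 2 * s z)" using sz by (simp add: power2_eq_square algebra_simps)
  finally have "deriv s z = of_nat k / 2 * (s z / z)" using \<open>s z \<noteq> 0\<close> z by (simp add: field_simps)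
  moreover have "s z = u \<or> s z = - u" using sz u power2_eq_iff by metis
  ultimately show ?thesis unfolding \<beta>_eq by auto
qed

text \<open>Coordinates adapted to the cylindrical model: the complex part is \<open>z\<close>, the
  real part is the position along the axis.\<close>

definition cpx_vec :: "complex \<times> real \<Rightarrow> real^3" where
  "cpx_vec p = Re (fst p) *\<^sub>R axis 1 1 + Im (fst p) *\<^sub>R axis 2 1 + snd p *\<^sub>R axis 3 1"

lemma cpx_vec_nth [simp]:
  "cpx_vec p $ 1 = Re (fst p)" "cpx_vec p $ 2 = Im (fst p)" "cpx_vec p $ 3 = snd p"
  by (simp_all add: cpx_vec_def axis_def)

lemma cpx_vec_Complex [simp]:
  fixes x :: "real^3"
  shows "cpx_vec (Complex (x $ 1) (x $ 2), x $ 3) = x"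
  by (simp add: vec_eq_iff forall_3)

lemma bounded_linear_cpx_vec: "bounded_linear cpx_vec"
  by (rule linear_conv_bounded_linear[THEN iffD1], rule linearI) (simp_all add: vec_eq_iff forall_3)

lemma norm_vec3:
  fixes x :: "real^3"
  shows "(norm x)\<^sup>2 = (cmod (Complex (x $ 1) (x $ 2)))\<^sup>2 + (x $ 3)\<^sup>2"
  unfolding cmod_power2 unfolding power2_norm_eq_inner
  by (simp add: inner_vec_def sum_3 power2_eq_square)

text \<open>After division by \<open>u\<close> the cut of \<open>Ln\<close> is the ray from 0
  through \<open>-u\<close>. A ray from \<open>u\<close> in direction \<omega> meets it only if
  \<open>\<omega> / u\<close> is a nonpositive real number. This cannot happen for both
  \<open>1 + \<i>\<close> and \<open>1 - \<i>\<close>, which are not real multiples of the same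
  number. Either one has real part 1, so \<open>Re du\<close> grows at unit rate.\<close>

lemma avoid_nonpos_Reals_ray:
  assumes "u \<noteq> 0"
  obtains \<omega> where "Re \<omega> = 1" "norm \<omega> \<le> 2" "\<And>t. 0 \<le> t \<Longrightarrow> (u + of_real t * \<omega>) / u \<notin> \<real>\<^sub>\<le>\<^sub>0"
proof -
  have "(1 + \<i>) / u \<notin> \<real>\<^sub>\<le>\<^sub>0 \<or> (1 - \<i>) / u \<notin> \<real>\<^sub>\<le>\<^sub>0"
  proof (rule ccontr)
    assume "\<not> ?thesis"
    then obtain a b where "(1 + \<i>) / u = of_real a" "(1 - \<i>) / u = of_real b"
      by (auto elim!: nonpos_Reals_cases)
    then have ab: "1 + \<i> = of_real a * u" "1 - \<i> = of_real b * u" using assms by (auto simp: field_simps)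
    have "of_real b * (1 + \<i>) = of_real a * (of_real b * u)" by (simp add: ab(1))
    also have "\<dots> = of_real a * (1 - \<i>)" by (simp only: ab(2))
    finally have "of_real b * (1 + \<i>) = of_real a * (1 - \<i>)" .
    then have "a = 0" by (auto simp: complex_eq_iff)
    then show False using ab(1) by (auto simp: complex_eq_iff)
  qed
  then obtain \<omega> where \<omega>: "\<omega> = 1 + \<i> \<or> \<omega> = 1 - \<i>" "\<omega> / u \<notin> \<real>\<^sub>\<le>\<^sub>0" by blast
  have "(u + of_real t * \<omega>) / u \<notin> \<real>\<^sub>\<le>\<^sub>0" if t: "0 \<le> t" for t
  proof
    assume "(u + of_real t * \<omega>) / u \<in> \<real>\<^sub>\<le>\<^sub>0"
    then obtain c where c: "(u + of_real t * \<omega>) / u = of_real c" "c \<le> 0" by (auto elim: nonpos_Reals_cases)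
    then have *: "of_real t * (\<omega> / u) = of_real (c - 1)" using assms by (simp add: field_simps)
    then have "t \<noteq> 0" using c(2) by (auto simp del: of_real_diff)
    then have "\<omega> / u = of_real ((c - 1) / t)" using * by (simp add: field_simps)
    moreover have "(c - 1) / t \<le> 0" using c(2) t by (simp add: divide_nonpos_nonneg)
    ultimately show False using \<omega>(2) by (metis nonpos_Reals_of_real_iff)
  qed
  moreover have "norm \<omega> \<le> 2"
    using \<omega>(1) norm_triangle_ineq[of 1 \<i>] norm_triangle_ineq4[of 1 \<i>] by auto
  ultimately show thesis using that[of \<omega>] \<omega>(1) by auto
qed

text \<open>\<zeta> is the branch of \<open>u^(2/k)\<close> with value \<open>z0\<close> at
  \<open>u0\<close>. Dividing by \<open>u0\<close> before taking the logarithm puts the cut opposite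
  to \<open>u0\<close>, wherever \<open>u0\<close> lies.\<close>

lemma root_branch:
  assumes "z0 \<noteq> 0" "u0 \<noteq> 0" "u0\<^sup>2 = z0 ^ k" "k > 0"
  defines "\<zeta> \<equiv> \<lambda>u. z0 * exp (2 / of_nat k * Ln (u / u0))"
  shows "\<zeta> u0 = z0" "\<zeta> u \<noteq> 0"
    and "u / u0 \<notin> \<real>\<^sub>\<le>\<^sub>0 \<Longrightarrow> \<zeta> u ^ k = u\<^sup>2"
    and "u / u0 \<notin> \<real>\<^sub>\<le>\<^sub>0 \<Longrightarrow> (\<zeta> has_field_derivative 2 / of_nat k * (\<zeta> u / u)) (at u)"
proof -
  show "\<zeta> u0 = z0" "\<zeta> u \<noteq> 0" using assms by (auto simp: \<zeta>_def)
  assume u: "u / u0 \<notin> \<real>\<^sub>\<le>\<^sub>0"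
  then have u0: "u / u0 \<noteq> 0" by auto
  have "\<zeta> u ^ k = z0 ^ k * exp (of_nat k * (2 / of_nat k * Ln (u / u0)))"
    by (simp add: \<zeta>_def power_mult_distrib exp_of_nat_mult[symmetric])
  also have "of_nat k * (2 / of_nat k * Ln (u / u0)) = of_nat 2 * Ln (u / u0)" using assms(4) by simp
  also have "exp \<dots> = (u / u0)\<^sup>2" using u0 by (subst exp_of_nat_mult) (simp add: exp_Ln)
  also have "z0 ^ k * (u / u0)\<^sup>2 = u\<^sup>2" using assms(1-3) by (simp add: power_divide)
  finally show "\<zeta> u ^ k = u\<^sup>2" .
  have "((\<lambda>u. u / u0) has_field_derivative 1 / u0) (at u)"
    using assms(2) by (auto intro!: derivative_eq_intros)
  then have "((\<lambda>u. Ln (u / u0)) has_field_derivative inverse (u / u0) * (1 / u0)) (at u)"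
    by (rule DERIV_chain2[of Ln _ "\<lambda>u. u / u0", OF has_field_derivative_Ln[OF u]])
  then have "((\<lambda>u. 2 / of_nat k * Ln (u / u0)) has_field_derivative
      2 / of_nat k * (inverse (u / u0) * (1 / u0))) (at u)"
    by (rule DERIV_cmult)
  then have "((\<lambda>u. exp (2 / of_nat k * Ln (u / u0))) has_field_derivative
      exp (2 / of_nat k * Ln (u / u0)) * (2 / of_nat k * (inverse (u / u0) * (1 / u0)))) (at u)"
    by (rule DERIV_chain2[OF DERIV_exp])
  then have "(\<zeta> has_field_derivative
      z0 * (exp (2 / of_nat k * Ln (u / u0)) * (2 / of_nat k * (inverse (u / u0) * (1 / u0))))) (at u)"
    unfolding \<zeta>_def by (rule DERIV_cmult)
  moreover have "inverse (u / u0) * (1 / u0) = 1 / u" using assms(2) by simp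
  ultimately show "(\<zeta> has_field_derivative 2 / of_nat k * (\<zeta> u / u)) (at u)"
    using assms(2) by (simp add: \<zeta>_def mult_ac)
qed

text \<open>In the coordinate \<open>z\<close> the form has size comparable to
  \<open>|z|^(k/2-1)\<close>, so straight lines in the chart give no gain bounded below near
  \<open>Z\<close>. In the root coordinate the form is \<open>f * Re du\<close>, whose coefficient
  is bounded below, and all starting points near \<open>q\<close> have room of a fixed size.\<close>

lemma locally_good_cylindrical:
  assumes cyl: "cylindrical M Z V q" and qZ: "q \<in> Z"
    and ne: "\<And>p. p \<in> M \<Longrightarrow> zero_ext Z V p \<noteq> {}"
  obtains N \<delta> where "open N" "q \<in> N" "\<delta> > 0"
    "\<And>y. y \<in> N \<inter> M \<Longrightarrow> locally_good M (M - Z) (abs_val Z V) \<delta> y"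
proof -
  obtain \<phi> W f k where C: "(\<phi>, W) \<in> charts M" "q \<in> \<phi> ` W" "smooth_on W f"
      "\<And>x. x \<in> W \<Longrightarrow> f x \<noteq> (0::real)" "3 \<le> k"
    and eq: "\<And>x. x \<in> W \<Longrightarrow> (\<lambda>\<alpha> h. \<alpha> (frechet_derivative \<phi> (at x) h)) ` zero_ext Z V (\<phi> x)
              = (\<lambda>\<beta> h. f x * \<beta> h) ` Re_d_sqrt_pow k x"
    using cyl unfolding cylindrical_def by metis
  define D where "D x = frechet_derivative \<phi> (at x)" for x
  define zc where "zc x = Complex (x $ 1) (x $ 2)" for x :: "real^3"
  have k: "of_nat k \<noteq> (0::complex)" "k > 0" using C(5) by auto
  have inM: "\<phi> x \<in> M" if "x \<in> W" for x using chart_subset[OF C(1)] that by auto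
  \<comment> \<open>The model equation is one between sets of values. It determines
    \<open>abs_val\<close> as soon as all model values agree up to sign.\<close>
  have val: "abs_val Z V (\<phi> x) (D x h) = \<bar>f x\<bar> * c"
    if "x \<in> W" and c: "\<And>\<beta>. \<beta> \<in> Re_d_sqrt_pow k x \<Longrightarrow> \<bar>\<beta> h\<bar> = c" for x h c
  proof (rule abs_val_eqI[OF ne[OF inM[OF that(1)]]])
    fix \<alpha> assume "\<alpha> \<in> zero_ext Z V (\<phi> x)"
    then have "(\<lambda>h. \<alpha> (D x h)) \<in> (\<lambda>\<beta> h. f x * \<beta> h) ` Re_d_sqrt_pow k x"
      unfolding eq[OF that(1), symmetric] D_def by (rule imageI)
    then obtain \<beta> where "\<beta> \<in> Re_d_sqrt_pow k x" "(\<lambda>h. \<alpha> (D x h)) = (\<lambda>h. f x * \<beta> h)" by auto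
    then show "\<bar>\<alpha> (D x h)\<bar> = \<bar>f x\<bar> * c" using c by (metis abs_mult)
  qed
  have val0: "abs_val Z V (\<phi> x) (D x h) = 0" if "x \<in> W" "zc x = 0" for x h
    using val[of x h 0] that by (simp add: Re_d_sqrt_pow_def zc_def)
  have val1: "abs_val Z V (\<phi> x) (D x h) = \<bar>f x\<bar> * \<bar>Re (of_nat k / 2 * (u / zc x) * zc h)\<bar>"
    if "x \<in> W" "zc x \<noteq> 0" "u\<^sup>2 = zc x ^ k" for x h u
    using val[OF that(1)] Re_d_sqrt_pow_cases[of x u k] that(2,3) by (simp add: zc_def)
  \<comment> \<open>Within the chart, points of \<open>Z\<close> have \<open>z = 0\<close>:
    otherwise the model form takes the value \<open>|c|^2\<close>, which is nonzero, on the vector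
    with complex part \<open>cnj c\<close>.\<close>
  have notZ: "\<phi> x \<notin> Z" if x: "x \<in> W" "zc x \<noteq> 0" for x
  proof
    assume "\<phi> x \<in> Z"
    then have zero: "abs_val Z V (\<phi> x) h = 0" for h by (intro abs_val_eqI) (auto simp: zero_ext_def)
    define u where "u = csqrt (zc x ^ k)"
    define c where "c = of_nat k / 2 * (u / zc x)"
    have u: "u\<^sup>2 = zc x ^ k" by (simp add: u_def)
    then have "c \<noteq> 0" using x(2) k by (auto simp: c_def)
    have "zc (cpx_vec (cnj c, 0)) = cnj c" by (simp add: zc_def complex_eq_iff)
    then have "\<bar>f x\<bar> * \<bar>Re (c * cnj c)\<bar> = 0"
      using val1[OF x u, of "cpx_vec (cnj c, 0)"] zero by (simp add: c_def)
    then have "Re (c * cnj c) = 0" using C(4)[OF x(1)] by simp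
    then show False using \<open>c \<noteq> 0\<close> by (simp add: complex_mult_cnj complex_eq_iff)
  qed
  obtain x1 where x1: "x1 \<in> W" "\<phi> x1 = q" using C(2) by auto
  have zx1: "zc x1 = 0" using notZ[OF x1(1)] x1(2) qZ by auto
  define s1 where "s1 = x1 $ 3"
  obtain K r0 where K: "K > 0" "r0 > 0" "ball x1 r0 \<subseteq> W"
    "\<And>x u. x \<in> ball x1 r0 \<Longrightarrow> u \<in> tangent_space M (\<phi> x) \<Longrightarrow>
      \<exists>h. u = D x h \<and> norm h \<le> K * norm u"
    using chart_tangent_lift[OF C(1) x1(1)] unfolding D_def by metis
  define m where "m = \<bar>f x1\<bar> / 2"
  have m: "m > 0" using C(4)[OF x1(1)] by (simp add: m_def)
  have "continuous_on (ball x1 r0) f" using smooth_on_continuous_on[OF C(3)] K(3) continuous_on_subset by blast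
  then have "isCont f x1" using K(2) by (simp add: continuous_on_eq_continuous_at)
  then obtain r1 where r1: "r1 > 0" "\<And>x. dist x x1 < r1 \<Longrightarrow> dist (f x) (f x1) < m"
    using m unfolding continuous_at_eps_delta by metis
  \<comment> \<open>The halving makes the cylinder \<open>|z| < r\<close>,
    \<open>|x3 - s1| < r\<close> fit into the ball of radius \<open>2 * r\<close>, where
    \<open>f\<close> is controlled; \<open>r \<le> 1\<close> is used later to bound a power of
    \<open>|z|\<close>.\<close>
  define r where "r = min (min r0 r1 / 2) 1"
  have r: "r > 0" "r \<le> 1" "2 * r \<le> r0" "2 * r \<le> r1" using K r1 by (auto simp: r_def)
  have box: "x \<in> ball x1 r0 \<and> m \<le> \<bar>f x\<bar> \<and> \<bar>f x\<bar> \<le> 3 * m"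
    if "cmod (zc x) < r" "\<bar>x $ 3 - s1\<bar> < r" for x :: "real^3"
  proof -
    have "zc (x - x1) = zc x" using zx1 by (simp add: zc_def complex_eq_iff)
    then have "(norm (x - x1))\<^sup>2 = (cmod (zc x))\<^sup>2 + \<bar>x $ 3 - s1\<bar>\<^sup>2"
      using norm_vec3[of "x - x1"] by (simp add: s1_def zc_def)
    also have "\<dots> < r\<^sup>2 + r\<^sup>2" using that by (intro add_strict_mono power_strict_mono) auto
    also have "\<dots> \<le> (2 * r)\<^sup>2" by (simp add: power2_eq_square)
    finally have "norm (x - x1) < 2 * r" by (rule power2_less_imp_less) (use r in simp)
    then have d: "dist x x1 < 2 * r" by (simp add: dist_norm)
    then have "\<bar>f x - f x1\<bar> < m" using r1(2)[of x] r by (simp add: dist_real_def)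
    then have "m \<le> \<bar>f x\<bar>" "\<bar>f x\<bar> \<le> 3 * m" unfolding m_def by linarith+
    then show ?thesis using d r by (simp add: dist_commute)
  qed
  have boxW: "x \<in> W" if "cmod (zc x) < r" "\<bar>x $ 3 - s1\<bar> < r" for x :: "real^3" using box[OF that] K(3) by auto
  \<comment> \<open>For \<open>u^2 = z^k\<close> the condition \<open>|z| < r\<close> becomes
    \<open>|u| < R\<close>. Points of \<open>B0\<close> have roots with \<open>|u| < R / 4\<close>;
    a ray of speed at most 2, followed for the time \<open>R / 8\<close>, adds at most
    \<open>R / 4\<close>, so it stays within \<open>|u| < R\<close>.\<close>
  define R where "R = sqrt (r ^ k)"
  have R: "R > 0" "R\<^sup>2 = r ^ k" using r by (simp_all add: R_def)
  define B0 where "B0 = ball x1 r0 \<inter> {x. cmod (zc x) < r \<and> \<bar>x $ 3 - s1\<bar> < r \<and> cmod (zc x) ^ k < (R / 4)\<^sup>2}"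
  have czc: "continuous_on UNIV zc"
    unfolding zc_def by (intro continuous_intros continuous_on_component)
  have "open B0"
    unfolding B0_def
    by (intro open_Int open_ball open_Collect_conj open_Collect_less continuous_intros czc continuous_on_component)
  moreover have "x1 \<in> B0" using K(2) r R k zx1 by (simp add: B0_def s1_def zero_power)
  ultimately obtain N where N: "open N" "q \<in> N" "N \<inter> M = \<phi> ` B0"
    using chart_image_nhd[OF C(1), of B0 x1] K(3) x1(2) by (auto simp: B0_def)
  define T where "T = R / 8"
  \<comment> \<open>The denominator collects the upper bounds for \<open>|f|\<close>, for the
    derivative of the root and for the lift; the other entry is the gain of
    \<open>turning_segment\<close> with \<open>c = m\<close>.\<close>
  define \<delta> where "\<delta> = min (1 / (3 * m * (of_nat k / 2) * K)) (m * T / 2)"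
  have T: "T > 0" using R by (simp add: T_def)
  have \<delta>: "\<delta> > 0" using m T K(1) k(2) by (simp add: \<delta>_def)
  have "locally_good M (M - Z) (abs_val Z V) \<delta> y" if y: "y \<in> N \<inter> M" for y
    unfolding locally_good_def
  proof (intro ballI conjI impI)
    obtain x where x: "x \<in> B0" "y = \<phi> x" using y N(3) by auto
    have zr: "cmod (zc x) < r" and sr: "\<bar>x $ 3 - s1\<bar> < r" and zR: "cmod (zc x) ^ k < (R / 4)\<^sup>2"
      and xr0: "x \<in> ball x1 r0" and xW: "x \<in> W"
      using x(1) K(3) by (auto simp: B0_def)
    fix u assume u: "u \<in> tangent_space M y"
    then obtain h where h: "u = D x h" "norm h \<le> K * norm u"
      using K(4)[OF xr0] x(2) by auto
    have zh: "cmod (zc h) \<le> norm h"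
      by (rule power2_le_imp_le) (simp_all add: norm_vec3 zc_def)
    have "abs_val Z V y u \<le> 3 * m * (of_nat k / 2) * (K * norm u)"
    proof (cases "zc x = 0")
      case True
      then show ?thesis using val0[OF xW] x(2) h(1) m K(1) by simp
    next
      case False
      define b where "b = csqrt (zc x ^ k)"
      have b: "b\<^sup>2 = zc x ^ k" by (simp add: b_def)
      \<comment> \<open>This amounts to \<open>|b / z|^2 = |z|^(k-2)\<close>, which is at most 1
        since \<open>k\<close> is at least 3: the form stays bounded at the axis.\<close>
      then have "(cmod (b / zc x))\<^sup>2 * (cmod (zc x))\<^sup>2 = cmod (zc x) ^ k"
        using False by (metis nonzero_eq_divide_eq norm_mult norm_power power_mult_distrib)
      also have "\<dots> = cmod (zc x) ^ (k - 2) * (cmod (zc x))\<^sup>2"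
        using C(5) by (subst power_add[symmetric]) (rule arg_cong[of _ _ "power _"], simp)
      finally have "(cmod (b / zc x))\<^sup>2 = cmod (zc x) ^ (k - 2)" using False by simp
      also have "\<dots> \<le> 1" using zr r by (intro power_le_one) auto
      finally have "cmod (b / zc x) \<le> 1" using power2_le_imp_le[of "cmod (b / zc x)" 1] by simp
      then have "cmod (of_nat k / 2 * (b / zc x) * zc h) \<le> of_nat k / 2 * 1 * norm h"
        unfolding norm_mult using zh by (intro mult_mono) auto
      then have "\<bar>Re (of_nat k / 2 * (b / zc x) * zc h)\<bar> \<le> of_nat k / 2 * (K * norm u)"
        using abs_Re_le_cmod h(2) by (smt (verit) mult.commute mult_1 mult_left_mono of_nat_0_le_iff divide_nonneg_nonneg)
      then have "\<bar>f x\<bar> * \<bar>Re (of_nat k / 2 * (b / zc x) * zc h)\<bar> \<le> 3 * m * (of_nat k / 2 * (K * norm u))"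
        using box[OF zr sr] m by (intro mult_mono) auto
      then show ?thesis using val1[OF xW False b, of h] x(2) h(1) by (simp add: mult.assoc)
    qed
    then have "\<delta> * abs_val Z V y u \<le> \<delta> * (3 * m * (of_nat k / 2) * (K * norm u))"
      using \<delta> by (intro mult_left_mono) auto
    also have "\<dots> \<le> 1 / (3 * m * (of_nat k / 2) * K) * (3 * m * (of_nat k / 2) * (K * norm u))"
      using m K(1) by (intro mult_right_mono) (auto simp: \<delta>_def)
    also have "\<dots> = norm u" using m K(1) k(2) by simp
    finally show "\<delta> * abs_val Z V y u \<le> norm u" .
    assume "y \<in> M - Z \<and> 0 < abs_val Z V y u"
    then have wpos: "0 < abs_val Z V y u" by simp
    then have z0: "zc x \<noteq> 0" using val0[OF xW] x(2) h(1) by (metis less_irrefl)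
    define v where "v = csqrt (zc x ^ k)"
    define g where "g b = of_nat k / 2 * (b / zc x) * zc h" for b
    have "v\<^sup>2 = zc x ^ k" by (simp add: v_def)
    then have "Re (g v) \<noteq> 0" using val1[OF xW z0, of v h] wpos x(2) h(1) by (auto simp: g_def)
    \<comment> \<open>Of the two roots, the one whose differential has positive real part on
      \<open>h\<close>.\<close>
    define b where "b = (if Re (g v) > 0 then v else - v)"
    have b: "b\<^sup>2 = zc x ^ k" by (simp add: b_def v_def)
    have gb: "Re (g b) > 0" using \<open>Re (g v) \<noteq> 0\<close> by (auto simp: b_def g_def)
    have b0: "b \<noteq> 0" using b z0 by auto
    have bR: "cmod b < R / 4"
    proof (rule power2_less_imp_less)
      show "(cmod b)\<^sup>2 < (R / 4)\<^sup>2" using b zR by (metis norm_power)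
    qed (use R in simp)
    obtain \<omega> where \<omega>: "Re \<omega> = 1" "norm \<omega> \<le> 2" "\<And>t. 0 \<le> t \<Longrightarrow> (b + of_real t * \<omega>) / b \<notin> \<real>\<^sub>\<le>\<^sub>0"
      using avoid_nonpos_Reals_ray[OF b0] by blast
    define \<zeta> where "\<zeta> c = zc x * exp (2 / of_nat k * Ln (c / b))" for c
    note \<zeta> = root_branch[OF z0 b0 b k(2), folded \<zeta>_def]
    define J where "J p = cpx_vec (\<zeta> (fst p), snd p)" for p
    define J' where "J' p h = cpx_vec (2 / of_nat k * (\<zeta> (fst p) / fst p) * fst h, snd h)"
      for p h :: "complex \<times> real"
    \<comment> \<open>A disc slit opposite to \<open>b\<close>, times an interval of the axis. On it
      \<open>J\<close> parametrizes points of the chart by a root of \<open>z^k\<close> and the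
      third coordinate.\<close>
    define B where "B = {p. fst p / b \<notin> \<real>\<^sub>\<le>\<^sub>0 \<and> cmod (fst p) < R \<and> \<bar>snd p - s1\<bar> < r}"
    have zcJ: "zc (J p) = \<zeta> (fst p)" for p by (simp add: J_def zc_def)
    have B_z: "(\<zeta> (fst p)) ^ k = (fst p)\<^sup>2" "fst p \<noteq> 0" "cmod (\<zeta> (fst p)) < r" "J p \<in> W" "m \<le> \<bar>f (J p)\<bar>"
      if "p \<in> B" for p
    proof -
      show 1: "(\<zeta> (fst p)) ^ k = (fst p)\<^sup>2" using \<zeta>(3) that by (simp add: B_def)
      show "fst p \<noteq> 0" using that by (auto simp: B_def)
      have "cmod (\<zeta> (fst p)) ^ k = (cmod (fst p))\<^sup>2" using 1 by (metis norm_power)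
      also have "\<dots> < r ^ k" using that unfolding R(2)[symmetric] B_def by (intro power_strict_mono) auto
      finally show 2: "cmod (\<zeta> (fst p)) < r" by (rule power_less_imp_less_base) (use r in simp)
      have 3: "\<bar>J p $ 3 - s1\<bar> < r" using that by (simp add: J_def B_def)
      show "J p \<in> W" "m \<le> \<bar>f (J p)\<bar>" using boxW[of "J p"] box[of "J p"] 2 3 by (simp_all add: zcJ)
    qed
    have wJ: "abs_val Z V (\<phi> (J p)) (D (J p) (J' p h)) = \<bar>(complex_of_real \<bar>f (J p)\<bar>, 0) \<bullet> h\<bar>" if p: "p \<in> B" for p h
    proof -
      \<comment> \<open>The factor \<open>k / 2 * (u / z)\<close> of the form cancels the factor
        \<open>2 / k * (z / u)\<close> from the derivative of the branch, which leaves
        \<open>|f|\<close> times \<open>|Re du|\<close>.\<close>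
      have *: "of_nat k / 2 * (c / w) * (2 / of_nat k * (w / c) * d) = d" if "c \<noteq> 0" "w \<noteq> 0" for c d w :: complex
        using that k by (simp add: field_simps)
      have "abs_val Z V (\<phi> (J p)) (D (J p) (J' p h)) =
          \<bar>f (J p)\<bar> * \<bar>Re (of_nat k / 2 * (fst p / zc (J p)) * zc (J' p h))\<bar>"
        using B_z[OF p] \<zeta>(2) by (intro val1) (simp_all add: zcJ)
      also have "zc (J' p h) = 2 / of_nat k * (\<zeta> (fst p) / fst p) * fst h" by (simp add: J'_def zc_def)
      finally show ?thesis
        unfolding zcJ *[OF B_z(2)[OF p] \<zeta>(2)] by (cases h) (simp add: inner_complex_def abs_mult)
    qed
    have dJ: "(J has_derivative J' p) (at p)" if "p \<in> B" for p
    proof -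
      have "fst p / b \<notin> \<real>\<^sub>\<le>\<^sub>0" using that by (simp add: B_def)
      then have "(\<zeta> has_derivative (\<lambda>h. 2 / of_nat k * (\<zeta> (fst p) / fst p) * h)) (at (fst p))"
        using \<zeta>(4)[of "fst p"] unfolding has_field_derivative_def by blast
      then have "((\<lambda>p. \<zeta> (fst p)) has_derivative (\<lambda>h. 2 / of_nat k * (\<zeta> (fst p) / fst p) * fst h)) (at p)"
        by (rule has_derivative_compose[OF has_derivative_fst[OF has_derivative_ident]])
      from has_derivative_Pair[OF this has_derivative_snd[OF has_derivative_ident]]
      show ?thesis unfolding J_def[abs_def] J'_def[abs_def]
        by (rule bounded_linear.has_derivative[OF bounded_linear_cpx_vec])
    qed
    have cJ: "continuous_on B J"
      using dJ by (meson continuous_at_imp_continuous_on has_derivative_continuous)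
    have c\<zeta>: "continuous_on B (\<lambda>p. \<zeta> (fst p))"
      using continuous_on_compose2[OF czc cJ] by (simp add: zcJ)
    have lin: "linear (D y)" if "y \<in> W" for y using chart_linear[OF C(1) that] by (simp add: D_def)
    have "open W" "smooth_on W \<phi>" using C(1) by (auto simp: charts_def diffeo_def)
    have cDJ: "continuous_on B (\<lambda>p. D (J p) h)" for h
      unfolding D_def
      by (rule continuous_on_compose2[OF smooth_on_continuous_derivative[OF \<open>open W\<close> \<open>smooth_on W \<phi>\<close>] cJ])
        (use B_z(4) in blast)
    have xJ: "J (b, x $ 3) = x" using cpx_vec_Complex[of x] by (simp add: J_def \<zeta>(1) zc_def)
    \<comment> \<open>\<open>g b\<close> is the differential of the root applied to
      \<open>h\<close>, so \<open>h0\<close> is the velocity \<open>h\<close> in the new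
      coordinates.\<close>
    define h0 where "h0 = (g b, h $ 3)"
    have "2 / of_nat k * (zc x / b) * g b = zc h" using z0 b0 k by (simp add: g_def field_simps)
    then have J'0: "J' (b, x $ 3) h0 = h"
      using cpx_vec_Complex[of h] by (simp add: J'_def h0_def \<zeta>(1) flip: zc_def)
    obtain \<eta> E where "pos_curve M (M - Z) (abs_val Z V) T \<eta> E" "\<eta> 0 = \<phi> (J (b, x $ 3))"
        "E 0 = D (J (b, x $ 3)) (J' (b, x $ 3) h0)"
        "m * T / 2 \<le> integral {0..T} (\<lambda>t. abs_val Z V (\<eta> t) (E t))"
    proof (rule turning_segment[of B "\<lambda>p. \<phi> (J p)" "\<lambda>p h. D (J p) (J' p h)" "\<lambda>p. (complex_of_real \<bar>f (J p)\<bar>, 0::real)" "M - Z"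
          "abs_val Z V" M m "(\<omega>, 0)" T "(b, x $ 3)" h0])
      have "open ((\<lambda>p::complex \<times> real. fst p / b) -` (- \<real>\<^sub>\<le>\<^sub>0))"
        by (rule open_vimage) (auto intro!: continuous_intros closed_nonpos_Reals_complex simp: b0)
      moreover have "B = (\<lambda>p. fst p / b) -` (- \<real>\<^sub>\<le>\<^sub>0) \<inter> {p. cmod (fst p) < R \<and> \<bar>snd p - s1\<bar> < r}"
        by (auto simp: B_def)
      ultimately show "open B"
        by (auto intro!: open_Int open_Collect_conj open_Collect_less continuous_intros)
      show "((\<lambda>p. \<phi> (J p)) has_derivative (\<lambda>h. D (J p) (J' p h))) (at p)" if "p \<in> B" for p
        using has_derivative_compose[OF dJ[OF that]] chart_has_derivative[OF C(1) B_z(4)[OF that]]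
        by (simp add: D_def)
      show "continuous_on B (\<lambda>p. D (J p) (J' p h))" for h
      proof (rule continuous_on_linear_apply[of B "\<lambda>p. D (J p)" "\<lambda>p. J' p h"])
        show "continuous_on B (\<lambda>p. J' p h)"
          unfolding J'_def
          by (intro bounded_linear.continuous_on[OF bounded_linear_cpx_vec] continuous_intros c\<zeta>) (use B_z(2) in auto)
      qed (use lin B_z(4) cDJ in auto)
      show "continuous_on B (\<lambda>p. (complex_of_real \<bar>f (J p)\<bar>, 0))"
        using B_z(4) by (intro continuous_intros continuous_on_compose2[OF smooth_on_continuous_on[OF C(3)] cJ]) auto
      show "\<phi> (J p) \<in> M - Z" if "p \<in> B" for p
        using inM notZ B_z(4)[OF that] \<zeta>(2) by (simp add: zcJ)
      show "D (J p) (J' p h) \<in> tangent_space M (\<phi> (J p))" if "p \<in> B" for p h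
        using chart_derivative_tangent[OF C(1) B_z(4)[OF that]] by (simp add: D_def)
      show "m \<le> (complex_of_real \<bar>f (J p)\<bar>, 0) \<bullet> (\<omega>, 0)" if "p \<in> B" for p
        using B_z(5)[OF that] \<omega>(1) by (simp add: inner_complex_def)
      show "(b, x $ 3) + t *\<^sub>R (\<omega>, 0) \<in> B" if "0 \<le> t" "t \<le> T" for t
      proof -
        have "cmod (b + t *\<^sub>R \<omega>) \<le> cmod b + t * cmod \<omega>"
          using norm_triangle_ineq[of b "t *\<^sub>R \<omega>"] that by simp
        also have "\<dots> \<le> cmod b + T * 2" using that \<omega>(2) by (intro add_left_mono mult_mono) auto
        also have "\<dots> < R" using bR R(1) by (simp add: T_def)
        finally show ?thesis using \<omega>(3)[OF that(1)] sr by (simp add: B_def scaleR_conv_of_real)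
      qed
      show "0 < (complex_of_real \<bar>f (J (b, x $ 3))\<bar>, 0) \<bullet> h0"
        using gb C(4)[OF xW] by (simp add: xJ h0_def inner_complex_def)
    qed (use wJ m T in auto)
    then show "\<exists>T \<eta> E. pos_curve M (M - Z) (abs_val Z V) T \<eta> E \<and> \<eta> 0 = y \<and> E 0 = u \<and>
        \<delta> \<le> integral {0..T} (\<lambda>t. abs_val Z V (\<eta> t) (E t))"
      using x(2) h(1) by (intro exI[of _ T] exI[of _ \<eta>] exI[of _ E]) (auto simp: \<delta>_def xJ J'0)
  qed
  then show thesis using that[OF N(1,2) \<delta>] by blast
qed

subsection \<open>Bounded distance and the contradiction\<close>

lemma abs_val_pair:
  assumes "zero_ext Z V p = {\<alpha>, (\<lambda>u. - \<alpha> u)}"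
  shows "abs_val Z V p u = \<bar>\<alpha> u\<bar>"
  by (rule abs_val_eqI) (use assms in auto)

lemma tangent_space_scale:
  assumes "u \<in> tangent_space M p" "c \<noteq> 0"
  shows "c *\<^sub>R u \<in> tangent_space M p"
proof -
  obtain \<gamma> e where \<gamma>: "e > 0" "\<And>t::real. \<bar>t\<bar> < e \<Longrightarrow> \<gamma> t \<in> M" "\<gamma> 0 = p"
      "(\<gamma> has_vector_derivative u) (at 0)"
    using assms(1) unfolding tangent_space_def by blast
  have "(\<gamma> has_derivative (\<lambda>t. t *\<^sub>R u)) (at 0)" using \<gamma>(4) by (simp add: has_vector_derivative_def)
  moreover have "((\<lambda>t. c * t) has_derivative (\<lambda>t. c * t)) (at 0)"
    by (auto intro!: derivative_eq_intros)
  ultimately have "((\<lambda>t. \<gamma> (c * t)) has_derivative (\<lambda>t. (c * t) *\<^sub>R u)) (at 0)"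
    using has_derivative_compose[of "\<lambda>t. c * t" "\<lambda>t. c * t" 0 UNIV \<gamma> "\<lambda>t. t *\<^sub>R u"] by simp
  then have "((\<lambda>t. \<gamma> (c * t)) has_vector_derivative c *\<^sub>R u) (at 0)"
    by (simp add: has_vector_derivative_def mult.commute)
  moreover have "\<gamma> (c * t) \<in> M" if "\<bar>t\<bar> < e / \<bar>c\<bar>" for t
    using that assms(2) by (intro \<gamma>(2)) (simp add: abs_mult field_simps)
  ultimately show ?thesis unfolding tangent_space_def using \<gamma>(1,3) assms(2)
    by (intro CollectI exI[of _ "\<lambda>t. \<gamma> (c * t)"] exI[of _ "e / \<bar>c\<bar>"]) auto
qed

text \<open>Linearity is available only on the tangent space; elsewhere both sides are 0, because
  scaling by \<open>c \<noteq> 0\<close> cannot make a vector tangent. This homogeneity permits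
  changes of parameter.\<close>

lemma cotangent_space_scale:
  assumes "\<alpha> \<in> cotangent_space M p" "c \<noteq> 0"
  shows "\<alpha> (c *\<^sub>R u) = c * \<alpha> u"
proof (cases "u \<in> tangent_space M p")
  case True
  then have "\<alpha> (c *\<^sub>R u + 0 *\<^sub>R u) = c * \<alpha> u + 0 * \<alpha> u"
    using assms(1) unfolding cotangent_space_def by blast
  then show ?thesis by simp
next
  case False
  then have "c *\<^sub>R u \<notin> tangent_space M p"
    using tangent_space_scale[of "c *\<^sub>R u" M p "inverse c"] assms(2) by auto
  then show ?thesis using False assms(1) by (simp add: cotangent_space_def)
qed

text \<open>Decreasing \<delta> weakens both bounds, so the minimum over a finite subcover works
  everywhere.\<close>

lemma compact_locally_good:
  assumes "compact M"
    and loc: "\<And>q. q \<in> M \<Longrightarrow> \<exists>N \<delta>. open N \<and> q \<in> N \<and> \<delta> > 0 \<and> (\<forall>y\<in>N \<inter> M. locally_good M G w \<delta> y)"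
  obtains \<delta> where "\<delta> > 0" "\<And>y. y \<in> M \<Longrightarrow> locally_good M G w \<delta> y"
proof -
  have mono: "locally_good M G w \<delta>' y" if "locally_good M G w \<delta> y" "0 < \<delta>'" "\<delta>' \<le> \<delta>" for \<delta> \<delta>' y
    unfolding locally_good_def
  proof (intro ballI conjI impI)
    fix u assume u: "u \<in> tangent_space M y"
    then have "\<delta> * w y u \<le> norm u" using that(1) by (simp add: locally_good_def)
    moreover have "\<delta>' * w y u \<le> \<delta> * w y u \<or> \<delta>' * w y u \<le> 0"
      using that(2,3) by (cases "0 \<le> w y u") (auto intro: mult_right_mono simp: mult_le_0_iff)
    ultimately show "\<delta>' * w y u \<le> norm u" using norm_ge_zero[of u] by linarith
    assume "y \<in> G \<and> 0 < w y u"
    then show "\<exists>T \<eta> E. pos_curve M G w T \<eta> E \<and> \<eta> 0 = y \<and> E 0 = u \<and>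
        \<delta>' \<le> integral {0..T} (\<lambda>t. w (\<eta> t) (E t))"
      using that(1,3) u unfolding locally_good_def by (meson order.trans)
  qed
  obtain N d where Nd: "\<And>q. q \<in> M \<Longrightarrow> open (N q) \<and> q \<in> N q \<and> d q > 0 \<and> (\<forall>y\<in>N q \<inter> M. locally_good M G w (d q) y)"
    using loc by metis
  obtain Q where Q: "Q \<subseteq> M" "finite Q" "M \<subseteq> (\<Union>q\<in>Q. N q)"
    using compactE_image[OF assms(1), of M N] Nd by (metis (no_types, lifting) UN_I subsetI)
  \<comment> \<open>Inserting 1 keeps \<open>Min\<close> meaningful for an empty subcover.\<close>
  define \<delta> where "\<delta> = Min (insert 1 (d ` Q))"
  have "\<delta> > 0" using Q Nd by (auto simp: \<delta>_def)
  moreover have "locally_good M G w \<delta> y" if y: "y \<in> M" for y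
  proof -
    obtain q where "q \<in> Q" "y \<in> N q" using subsetD[OF Q(3) y] by blast
    moreover from this have "\<delta> \<le> d q" using Q(2) by (simp add: \<delta>_def)
    ultimately show ?thesis using mono[of "d q" y \<delta>] Nd[of q] Q(1) y \<open>\<delta> > 0\<close> by auto
  qed
  ultimately show thesis using that by blast
qed

text \<open>The speed is constant and equal to the angle between \<open>x\<close> and
  \<open>y\<close>, hence at most \<open>pi\<close>.\<close>

lemma great_arc:
  fixes x y :: "real^4"
  assumes "x \<in> S3" "y \<in> S3"
  obtains \<sigma> where "\<sigma> \<in> curves_from_to S3 x y"
    "\<And>t. t \<in> {0..1} \<Longrightarrow> velocity \<sigma> t \<in> tangent_space S3 (\<sigma> t) \<and> norm (velocity \<sigma> t) \<le> pi"
proof -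
  define c where "c = x \<bullet> y"
  have xx: "x \<bullet> x = 1" "y \<bullet> y = 1" using assms by (auto simp: norm_eq_1)
  have c: "-1 \<le> c" "c \<le> 1" using Cauchy_Schwarz_ineq2[of x y] assms by (auto simp: c_def)
  define \<theta> where "\<theta> = arccos c"
  have \<theta>: "0 \<le> \<theta>" "\<theta> \<le> pi" "cos \<theta> = c" "sin \<theta> = sqrt (1 - c\<^sup>2)"
    using c arccos_bounded[of c] by (auto simp: \<theta>_def sin_arccos)
  \<comment> \<open>If \<open>sin \<theta> = 0\<close> the points are equal or antipodal and every
    unit vector orthogonal to \<open>x\<close> will do; otherwise \<open>n\<close> comes from one
    Gram-Schmidt step.\<close>
  obtain n where n: "x \<bullet> n = 0" "n \<bullet> n = 1" "y = cos \<theta> *\<^sub>R x + sin \<theta> *\<^sub>R n"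
  proof (cases "sin \<theta> = 0")
    case True
    then have "c\<^sup>2 = 1" using \<theta>(4) by simp
    have "(y - c *\<^sub>R x) \<bullet> (y - c *\<^sub>R x) = 0"
      using \<open>c\<^sup>2 = 1\<close> xx by (simp add: inner_diff_left inner_diff_right c_def inner_commute[of y x] power2_eq_square)
    then have "y = c *\<^sub>R x" by simp
    obtain m :: "real^4" where "m \<noteq> 0" "orthogonal x m"
      using orthogonal_to_vector_exists[of x] by auto
    then have "x \<bullet> (m /\<^sub>R norm m) = 0" "(m /\<^sub>R norm m) \<bullet> (m /\<^sub>R norm m) = 1"
      by (auto simp: orthogonal_def dot_square_norm power2_eq_square)
    then show thesis by (rule that) (use \<open>y = c *\<^sub>R x\<close> True \<theta>(3) in simp)
  next
    case False
    define n where "n = (y - c *\<^sub>R x) /\<^sub>R sin \<theta>"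
    have "1 - c\<^sup>2 \<ge> 0" using c by (simp add: abs_le_iff power2_le_iff_abs_le[of 1, simplified] abs_square_le_1)
    then have "sin \<theta> * sin \<theta> = 1 - c\<^sup>2" using \<theta>(4) by simp
    moreover have "(y - c *\<^sub>R x) \<bullet> (y - c *\<^sub>R x) = 1 - c\<^sup>2"
      using xx by (simp add: inner_diff_left inner_diff_right c_def inner_commute[of y x] power2_eq_square)
    moreover have "n \<bullet> n = ((y - c *\<^sub>R x) \<bullet> (y - c *\<^sub>R x)) / (sin \<theta> * sin \<theta>)"
      by (simp add: n_def divide_inverse)
    ultimately have "n \<bullet> n = 1" using False by (metis divide_self mult_eq_0_iff)
    moreover have "x \<bullet> n = 0" by (simp add: n_def inner_diff_right c_def xx)
    moreover have "y = cos \<theta> *\<^sub>R x + sin \<theta> *\<^sub>R n" using False \<theta>(3) by (simp add: n_def)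
    ultimately show thesis using that by blast
  qed
  define \<sigma> where "\<sigma> t = cos (\<theta> * t) *\<^sub>R x + sin (\<theta> * t) *\<^sub>R n" for t
  define D where "D t = \<theta> *\<^sub>R (cos (\<theta> * t) *\<^sub>R n - sin (\<theta> * t) *\<^sub>R x)" for t
  have nx: "n \<bullet> x = 0" using n(1) by (simp add: inner_commute)
  have d: "(\<sigma> has_vector_derivative D t) (at t)" for t
  proof -
    have "((\<lambda>t. cos (\<theta> * t)) has_real_derivative - sin (\<theta> * t) * \<theta>) (at t)"
      "((\<lambda>t. sin (\<theta> * t)) has_real_derivative cos (\<theta> * t) * \<theta>) (at t)"
      by (auto intro!: derivative_eq_intros)
    then have "(\<sigma> has_vector_derivative
        (cos (\<theta> * t) *\<^sub>R 0 + (- sin (\<theta> * t) * \<theta>) *\<^sub>R x) + (sin (\<theta> * t) *\<^sub>R 0 + (cos (\<theta> * t) * \<theta>) *\<^sub>R n)) (at t)"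
      unfolding \<sigma>_def[abs_def]
      by (intro has_vector_derivative_add has_vector_derivative_scaleR has_vector_derivative_const)
    then show ?thesis by (simp add: D_def scaleR_diff_right mult.commute)
  qed
  have S3: "\<sigma> t \<in> S3" for t
  proof -
    have "\<sigma> t \<bullet> \<sigma> t = (cos (\<theta> * t))\<^sup>2 + (sin (\<theta> * t))\<^sup>2"
      by (simp add: \<sigma>_def inner_add_left inner_add_right n nx xx power2_eq_square)
    then show ?thesis by (simp add: norm_eq_1)
  qed
  have vel: "velocity \<sigma> t = D t" if "t \<in> {0..1}" for t
    using vector_derivative_at_within_ivl[OF d] that by auto
  have tan: "D t \<in> tangent_space S3 (\<sigma> t)" for t
  proof -
    have "((\<lambda>s. t + s) has_vector_derivative 1) (at 0)"
      by (auto intro!: derivative_eq_intros simp: has_vector_derivative_def)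
    then have "(\<sigma> \<circ> (\<lambda>s. t + s) has_vector_derivative 1 *\<^sub>R D t) (at 0)"
      using d[of t] by (intro vector_diff_chain_at) auto
    then show ?thesis unfolding tangent_space_def
      using S3 by (intro CollectI exI[of _ "\<sigma> \<circ> (\<lambda>s. t + s)"] exI[of _ 1]) auto
  qed
  have normD: "norm (D t) \<le> pi" for t
  proof -
    define e where "e = cos (\<theta> * t) *\<^sub>R n - sin (\<theta> * t) *\<^sub>R x"
    have "e \<bullet> e = (cos (\<theta> * t))\<^sup>2 + (sin (\<theta> * t))\<^sup>2"
      by (simp add: e_def inner_diff_left inner_diff_right n nx xx power2_eq_square)
    then have "norm e = 1" by (simp add: norm_eq_1)
    then show ?thesis using \<theta> by (simp add: D_def flip: e_def)
  qed
  have "C1_curve 0 1 \<sigma>" unfolding C1_curve_def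
    using d by (intro exI[of _ D]) (auto simp: D_def[abs_def] has_vector_derivative_at_within intro!: continuous_intros)
  then have "piecewise_C1_curve \<sigma>" unfolding piecewise_C1_curve_def
    by (intro exI[of _ "{0, 1}"]) auto
  then have "\<sigma> \<in> curves_from_to S3 x y"
    using S3 n(3) by (auto simp: curves_from_to_def \<sigma>_def)
  then show thesis using that[of \<sigma>] vel tan normD by simp
qed

theorem theorem1p7:
  fixes g :: "real^4 \<Rightarrow> real^4 \<Rightarrow> real^4 \<Rightarrow> real"
  assumes "riemannian_metric S3 g"
  shows "\<not> (\<exists>Z V. z2_harmonic S3 g Z V \<and>
           (\<forall>p\<in>Z. cylindrical S3 Z V p) \<and>
           (\<forall>\<gamma>. transverse_arc S3 Z V \<gamma> \<longrightarrow> mu Z V \<gamma> = form_dist S3 Z V (\<gamma> 0) (\<gamma> 1)))"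
proof (rule notI, elim exE conjE)
  fix Z V
  assume harm: "z2_harmonic S3 g Z V" and cyl: "\<forall>p\<in>Z. cylindrical S3 Z V p"
    and tight: "\<forall>\<gamma>. transverse_arc S3 Z V \<gamma> \<longrightarrow> mu Z V \<gamma> = form_dist S3 Z V (\<gamma> 0) (\<gamma> 1)"
  let ?w = "abs_val Z V"
  have ZS: "Z \<subset> S3" using harm closedin_subset[of "top_of_set S3" Z] by (auto simp: z2_harmonic_def)
  have reg: "\<exists>U v. openin (top_of_set S3) U \<and> p \<in> U \<and> U \<subseteq> S3 - Z \<and> section_on U V v \<and> v p \<noteq> (\<lambda>u. 0)"
    if "p \<in> S3 - Z" for p
    using harm that unfolding z2_harmonic_def by meson
  have vals: "\<exists>U \<alpha>. U \<subseteq> S3 \<and> \<alpha> \<in> cotangent_space U p \<and> V p = {\<alpha>, (\<lambda>u. - \<alpha> u)} \<and> \<alpha> \<noteq> (\<lambda>u. 0)" if p: "p \<in> S3 - Z" for p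
  proof -
    obtain U v where "p \<in> U" "U \<subseteq> S3 - Z" "section_on U V v" "v p \<noteq> (\<lambda>u. 0)"
      using reg[OF p] by blast
    then show ?thesis
      by (intro exI[of _ U] exI[of _ "v p"]) (auto simp: section_on_def smooth_1form_def)
  qed
  \<comment> \<open>\<open>abs_val\<close> is a definite description and is determined only where
    values exist.\<close>
  have ne: "zero_ext Z V p \<noteq> {}" if "p \<in> S3" for p
    using vals[of p] that by (cases "p \<in> Z") (auto simp: zero_ext_def)
  have loc: "\<exists>N \<delta>. open N \<and> q \<in> N \<and> \<delta> > 0 \<and> (\<forall>y\<in>N \<inter> S3. locally_good S3 (S3 - Z) ?w \<delta> y)" if q: "q \<in> S3" for q
  proof (cases "q \<in> Z")
    case True
    then show ?thesis using locally_good_cylindrical[OF bspec[OF cyl True] True ne] by metis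
  next
    case False
    then obtain U v where U: "openin (top_of_set S3) U" "q \<in> U" "U \<subseteq> S3 - Z" "section_on U V v" "v q \<noteq> (\<lambda>u. 0)"
      using reg[of q] q by auto
    obtain \<phi> where \<phi>: "(\<phi>, ball 0 1) \<in> charts S3" "\<phi> 0 = q" using hemisphere_chart[of q] q by auto
    have "\<phi> 0 \<in> U" using U(2) \<phi>(2) by simp
    then obtain W where W: "0 \<in> W" "(\<phi>, W) \<in> charts S3" "(\<phi>, W) \<in> charts U"
      by (rule chart_restrict[OF \<phi>(1) U(1)]) auto
    show ?thesis
      using locally_good_regular[OF W(2,3,1) U(3,4)] U(5) \<phi>(2) by metis
  qed
  obtain \<delta> where \<delta>: "\<delta> > 0" "\<And>y. y \<in> S3 \<Longrightarrow> locally_good S3 (S3 - Z) ?w \<delta> y"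
    using compact_locally_good[OF compact_sphere loc] by blast
  have dist: "form_dist S3 Z V x y \<le> ennreal (pi / \<delta>)" if xy: "x \<in> S3" "y \<in> S3" for x y
  proof -
    obtain \<sigma> where \<sigma>: "\<sigma> \<in> curves_from_to S3 x y"
      "\<And>t. t \<in> {0..1} \<Longrightarrow> velocity \<sigma> t \<in> tangent_space S3 (\<sigma> t) \<and> norm (velocity \<sigma> t) \<le> pi"
      using great_arc[OF xy] by metis
    have le: "?w (\<sigma> t) (velocity \<sigma> t) \<le> pi / \<delta>" if t: "t \<in> {0..1}" for t
    proof -
      have "\<sigma> t \<in> S3" using \<sigma>(1) t unfolding curves_from_to_def by blast
      then have "\<delta> * ?w (\<sigma> t) (velocity \<sigma> t) \<le> pi"
        using \<delta>(2)[of "\<sigma> t"] \<sigma>(2)[OF t] unfolding locally_good_def by (meson order.trans)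
      then show ?thesis using \<delta>(1) by (simp add: field_simps)
    qed
    have "mu Z V \<sigma> \<le> (\<integral>\<^sup>+t\<in>{0..1::real}. ennreal (pi / \<delta>) \<partial>lborel)"
      unfolding mu_def
    proof (rule nn_integral_mono)
      show "ennreal (?w (\<sigma> t) (velocity \<sigma> t)) * indicator {0..1} t \<le> ennreal (pi / \<delta>) * indicator {0..1} t" for t
        using le[of t] by (simp add: indicator_def ennreal_leI)
    qed
    also have "\<dots> = ennreal (pi / \<delta>)" by (simp add: nn_integral_cmult_indicator)
    finally show ?thesis unfolding form_dist_def using \<sigma>(1) by (meson INF_lower2)
  qed
  have wscale: "?w p (c *\<^sub>R u) = c * ?w p u" if p: "p \<in> S3 - Z" "c > 0" for p c u
  proof -
    obtain U \<alpha> where "\<alpha> \<in> cotangent_space U p" "V p = {\<alpha>, (\<lambda>u. - \<alpha> u)}"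
      using vals[OF p(1)] by blast
    then show ?thesis
      using cotangent_space_scale[of \<alpha> U p c u] p
        abs_val_pair[of Z V p \<alpha>] by (simp add: zero_ext_def abs_mult)
  qed
  \<comment> \<open>Rescaled to \<open>{0..1}\<close> the curve is a transverse arc, so the second
    condition equates its length with the distance of its ends, which \<open>dist\<close>
    bounds.\<close>
  have bound: "integral {0..b} (\<lambda>t. ?w (\<gamma> t) (D t)) \<le> pi / \<delta>" if P: "pos_curve S3 (S3 - Z) ?w b \<gamma> D" and b: "b > 0" for b \<gamma> D
  proof -
    define \<sigma> where "\<sigma> t = \<gamma> (b * t)" for t
    define E where "E t = b *\<^sub>R D (b * t)" for t
    define I where "I = integral {0..b} (\<lambda>t. ?w (\<gamma> t) (D t))"
    have im: "(\<lambda>t. b * t) ` {0..1} \<subseteq> {0..b}" using b by (auto simp: mult_left_le)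
    then have bt: "b * t \<in> {0..b}" if "t \<in> {0..1}" for t using that by blast
    have d: "(\<sigma> has_vector_derivative E t) (at t within {0..1})" if t: "t \<in> {0..1}" for t
    proof -
      have "(\<gamma> has_derivative (\<lambda>s. s *\<^sub>R D (b * t))) (at (b * t) within {0..b})"
        using P bt[OF t] by (simp add: pos_curve_def has_vector_derivative_def)
      moreover have d2: "((\<lambda>t. b * t) has_derivative (\<lambda>s. b * s)) (at t within {0..1})"
        by (auto intro!: derivative_eq_intros)
      ultimately have "((\<lambda>t. \<gamma> (b * t)) has_derivative (\<lambda>s. (b * s) *\<^sub>R D (b * t))) (at t within {0..1})"
        using has_derivative_in_compose[OF d2 has_derivative_subset[OF _ im]] by blast
      then show ?thesis by (simp add: \<sigma>_def[abs_def] E_def has_vector_derivative_def mult.commute)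
    qed
    have vel: "velocity \<sigma> t = E t" if "t \<in> {0..1}" for t
      using vector_derivative_within_cbox[of 0 1 t \<sigma> "E t"] d[OF that] that by (simp add: cbox_interval)
    have G: "\<sigma> t \<in> S3 - Z" and wE: "?w (\<sigma> t) (E t) = b * ?w (\<gamma> (b * t)) (D (b * t))"
      and pos: "0 < ?w (\<gamma> (b * t)) (D (b * t))" if "t \<in> {0..1}" for t
      using P bt[OF that] wscale[of "\<gamma> (b * t)" b "D (b * t)"] b
      unfolding pos_curve_def \<sigma>_def E_def by blast+
    have cE: "continuous_on {0..1} E" unfolding E_def
      using P by (intro continuous_intros continuous_on_compose2[OF _ _ im]) (auto simp: pos_curve_def intro!: continuous_intros)
    \<comment> \<open>On the kernel all values of \<open>V\<close> vanish, whereas the form is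
      positive on the velocity.\<close>
    have notker: "velocity \<sigma> t \<notin> ker S3 V (\<sigma> t)" if t: "t \<in> {0..1}" for t
    proof
      assume "velocity \<sigma> t \<in> ker S3 V (\<sigma> t)"
      then have "?w (\<sigma> t) (E t) = 0"
        using G[OF t] ne[of "\<sigma> t"] vel[OF t]
        by (intro abs_val_eqI) (auto simp: ker_def zero_ext_def)
      then show False using wE[OF t] pos[OF t] b by simp
    qed
    have "transverse_arc S3 Z V \<sigma>"
      unfolding transverse_arc_def C1_curve_def using cE d G notker by blast
    then have eq: "mu Z V \<sigma> = form_dist S3 Z V (\<sigma> 0) (\<sigma> 1)" using tight by blast
    \<comment> \<open>Affine substitution: the factor \<open>1 / b\<close> it produces cancels the
      factor \<open>b\<close> by which the rescaled velocity increases the form, so the length is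
      preserved.\<close>
    have "((\<lambda>t. ?w (\<gamma> t) (D t)) has_integral I) (cbox 0 b)"
      using P unfolding I_def pos_curve_def by (simp add: integrable_continuous_real integrable_integral cbox_interval)
    then have "((\<lambda>t. ?w (\<gamma> (b *\<^sub>R t + 0)) (D (b *\<^sub>R t + 0))) has_integral (1 / \<bar>b\<bar> ^ DIM(real)) *\<^sub>R I)
        ((\<lambda>t. (1 / b) *\<^sub>R t + - ((1 / b) *\<^sub>R 0)) ` cbox 0 b)"
      using b by (intro has_integral_affinity) auto
    moreover have "(\<lambda>t. (1 / b) *\<^sub>R t + - ((1 / b) *\<^sub>R 0)) ` cbox 0 b = {0..1}"
      using b image_mult_atLeastAtMost[of "1 / b" 0 b] by (simp add: cbox_interval)
    ultimately have "((\<lambda>t. ?w (\<gamma> (b * t)) (D (b * t))) has_integral I / b) {0..1}"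
      using b by simp
    from has_integral_mult_right[OF this, of b]
    have "((\<lambda>t. b * ?w (\<gamma> (b * t)) (D (b * t))) has_integral I) {0..1}" using b by simp
    then have "((\<lambda>t. ?w (\<sigma> t) (velocity \<sigma> t)) has_integral I) {0..1}"
      by (rule has_integral_eq[rotated]) (simp add: vel wE)
    then have "mu Z V \<sigma> = ennreal I"
      unfolding mu_def using pos wE b vel
      by (intro nn_integral_has_integral_lebesgue') (auto intro!: less_imp_le)
    moreover have "mu Z V \<sigma> \<le> ennreal (pi / \<delta>)"
      unfolding eq using G[of 0] G[of 1] by (intro dist) auto
    moreover have "0 \<le> pi / \<delta>" using \<delta>(1) by simp
    ultimately show ?thesis by (simp add: I_def ennreal_le_iff)
  qed
  have iter: "\<exists>b \<gamma> D. pos_curve S3 (S3 - Z) ?w b \<gamma> D \<and> real n * \<delta> \<le> integral {0..b} (\<lambda>t. ?w (\<gamma> t) (D t))" for n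
  proof (induction n)
    \<comment> \<open>The lower bound is trivial here, but a first curve must exist. It starts at a
      point off \<open>Z\<close>, with a vector on which the nonzero covector there does not
      vanish.\<close>
    case 0
    obtain q where q: "q \<in> S3 - Z" using ZS by blast
    obtain U \<alpha> where U: "U \<subseteq> S3" "\<alpha> \<in> cotangent_space U q" "V q = {\<alpha>, (\<lambda>u. - \<alpha> u)}" "\<alpha> \<noteq> (\<lambda>u. 0)"
      using vals[OF q] by blast
    obtain u where u: "\<alpha> u \<noteq> 0" using U(4) unfolding fun_eq_iff by blast
    then have "u \<in> tangent_space U q" using U(2) by (auto simp: cotangent_space_def)
    then have "u \<in> tangent_space S3 q" using tangent_space_mono[OF U(1)] by auto
    moreover have "0 < ?w q u" using U(3) u q abs_val_pair[of Z V q \<alpha> u] by (simp add: zero_ext_def)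
    ultimately obtain T \<eta> E where "pos_curve S3 (S3 - Z) ?w T \<eta> E" "\<delta> \<le> integral {0..T} (\<lambda>t. ?w (\<eta> t) (E t))"
      using \<delta>(2)[of q] q unfolding locally_good_def by blast
    then show ?case using \<delta>(1) by (intro exI[of _ T] exI[of _ \<eta>] exI[of _ E]) auto
  next
    case (Suc n)
    then obtain b \<gamma> D where 1: "pos_curve S3 (S3 - Z) ?w b \<gamma> D"
      "real n * \<delta> \<le> integral {0..b} (\<lambda>t. ?w (\<gamma> t) (D t))" by blast
    then have "D b \<in> tangent_space S3 (\<gamma> b)" "\<gamma> b \<in> S3 - Z" "0 < ?w (\<gamma> b) (D b)"
      by (auto simp: pos_curve_def)
    then obtain T \<eta> E where 2: "pos_curve S3 (S3 - Z) ?w T \<eta> E" "\<eta> 0 = \<gamma> b" "E 0 = D b"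
      "\<delta> \<le> integral {0..T} (\<lambda>t. ?w (\<eta> t) (E t))"
      using \<delta>(2)[of "\<gamma> b"] unfolding locally_good_def by blast
    show ?case
      using pos_curve_glue[OF 1(1) 2(1,2,3)] 1(2) 2(4)
      by (intro exI[of _ "b + T"] exI conjI) (assumption, simp add: algebra_simps)
  qed
  moreover obtain n where n: "pi / \<delta> / \<delta> < real n" using reals_Archimedean2 by blast
  ultimately obtain b \<gamma> D where P: "pos_curve S3 (S3 - Z) ?w b \<gamma> D"
    "real n * \<delta> \<le> integral {0..b} (\<lambda>t. ?w (\<gamma> t) (D t))" by blast
  have big: "pi / \<delta> < real n * \<delta>" using n \<delta>(1) by (simp add: field_simps)
  \<comment> \<open>Over a degenerate interval the integral would be 0, which is below the required
    length.\<close>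
  moreover have "b > 0"
  proof (rule ccontr)
    assume "\<not> b > 0"
    then have "b = 0" using P(1) by (simp add: pos_curve_def)
    then have "real n * \<delta> \<le> 0" using P(2) by simp
    moreover have "0 < pi / \<delta>" using \<delta>(1) by simp
    ultimately show False using big by linarith
  qed
  ultimately show False using bound[OF P(1)] P(2) by linarith
qed

end
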